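(* Let $0<s<1$, $1\le p<\infty$, and let $\Omega\subset\mathbb{R}^d$ be an open set. Suppose that $\Omega$ admits a weak $(s,p)$-fractional Hardy inequality, i.e. there exists a constant $c=c(d,s,p,\Omega)$ such that for every $f\in C_c^\infty(\Omega)$ $$\int_\Omega\frac{|f(x)|^p}{d_\Omega(x)^{sp}}\,dx\le c\,\|f\|_{W^{s,p}(\Omega)}^p.$$ Then $$W^{s,p}_0(\Omega)=\left\{f\in W^{s,p}(\Omega):\int_\Omega\frac{|f(x)|^p}{d_\Omega(x)^{sp}}\,dx<\infty\right\}.$$
   Context: All functions are real-valued. $d_\Omega(x)=\mathrm{dist}(x,\partial\Omega)=\inf_{y\in\partial\Omega}|x-y|$. Fractional Sobolev space: $W^{s,p}(\Omega)=\{f\in L^p(\Omega): [f]_{W^{s,p}(\Omega)}<\infty\}$, where $[f]_{W^{s,p}(\Omega)}=\left(\int_\Omega\int_\Omega\frac{|f(x)-f(y)|^p}{|x-y|^{d+sp}}\,dy\,dx\right)^{1/p}$, with norm $\|f\|_{W^{s,p}(\Omega)}=\|f\|_{L^p(\Omega)}+[f]_{W^{s,p}(\Omega)}$. $C_c^\infty(\Omega)$ is the space of all smooth functions with compact support in $\Omega$, and $W^{s,p}_0(\Omega)$ is the closure of $C_c^\infty(\Omega)$ in $W^{s,p}(\Omega)$ with respect to this norm. *)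

theory Defs
  imports "HOL-Analysis.Analysis"
begin

(* Powers of extended nonnegative reals, used only for positive exponents a:
   then top has power top, and finite values have their real power. *)
definition ennreal_powr :: "ennreal \<Rightarrow> real \<Rightarrow> ennreal" (infixr "epowr" 80) where
  "x epowr a = (if x = top then top else ennreal (enn2real x powr a))"

(* Valued in ennreal, so that the infimum is infinite for an empty frontier (Omega the
   whole space); infdist would give 0 in that case. *)
definition bdist :: "'a::euclidean_space set \<Rightarrow> 'a \<Rightarrow> ennreal" where
  "bdist \<Omega> x = (INF y\<in>frontier \<Omega>. ennreal (norm (x - y)))"

definition Lp_norm :: "real \<Rightarrow> 'a::euclidean_space set \<Rightarrow> ('a \<Rightarrow> real) \<Rightarrow> ennreal" where
  "Lp_norm p \<Omega> f = (\<integral>\<^sup>+x. ennreal (\<bar>f x\<bar> powr p) \<partial>lebesgue_on \<Omega>) epowr (1 / p)"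

(* On the diagonal x = y the integrand is 0 / 0 = 0; the diagonal is a null set. *)
definition gagliardo_seminorm ::
    "real \<Rightarrow> real \<Rightarrow> 'a::euclidean_space set \<Rightarrow> ('a \<Rightarrow> real) \<Rightarrow> ennreal" where
  "gagliardo_seminorm s p \<Omega> f =
     (\<integral>\<^sup>+x. \<integral>\<^sup>+y. ennreal (\<bar>f x - f y\<bar> powr p / norm (x - y) powr (real DIM('a) + s * p))
        \<partial>lebesgue_on \<Omega> \<partial>lebesgue_on \<Omega>) epowr (1 / p)"

definition frac_sobolev_norm ::
    "real \<Rightarrow> real \<Rightarrow> 'a::euclidean_space set \<Rightarrow> ('a \<Rightarrow> real) \<Rightarrow> ennreal" where
  "frac_sobolev_norm s p \<Omega> f = Lp_norm p \<Omega> f + gagliardo_seminorm s p \<Omega> f"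

(* Elements are functions rather than classes modulo null sets, given as total functions
   whose values outside Omega are irrelevant. Hence frac_sobolev_norm is only a seminorm. *)
definition frac_sobolev :: "real \<Rightarrow> real \<Rightarrow> 'a::euclidean_space set \<Rightarrow> ('a \<Rightarrow> real) set" where
  "frac_sobolev s p \<Omega> =
     {f \<in> borel_measurable (lebesgue_on \<Omega>).
        Lp_norm p \<Omega> f < top \<and> gagliardo_seminorm s p \<Omega> f < top}"

primrec times_continuously_differentiable :: "nat \<Rightarrow> ('a::euclidean_space \<Rightarrow> real) \<Rightarrow> bool" where
  "times_continuously_differentiable 0 f \<longleftrightarrow> continuous_on UNIV f"
| "times_continuously_differentiable (Suc k) f \<longleftrightarrow>
     f differentiable_on UNIV \<and>
     (\<forall>i\<in>Basis. times_continuously_differentiable k (\<lambda>x. frechet_derivative f (at x) i))"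

(* A smooth function on Omega with compact support in Omega is identified with its
   extension by zero, which is smooth on the whole space. *)
definition test_functions :: "'a::euclidean_space set \<Rightarrow> ('a \<Rightarrow> real) set" where
  "test_functions \<Omega> =
     {f. (\<forall>k. times_continuously_differentiable k f) \<and>
         compact (closure {x. f x \<noteq> 0}) \<and> closure {x. f x \<noteq> 0} \<subseteq> \<Omega>}"

(* Closure of the test functions in frac_sobolev s p Omega for the norm; it is written
   out since functions that agree almost everywhere have distance 0, so that
   frac_sobolev_norm does not give a metric space. *)
definition frac_sobolev_zero :: "real \<Rightarrow> real \<Rightarrow> 'a::euclidean_space set \<Rightarrow> ('a \<Rightarrow> real) set" where
  "frac_sobolev_zero s p \<Omega> =
     {f \<in> frac_sobolev s p \<Omega>.
        \<forall>\<epsilon>>0. \<exists>g\<in>test_functions \<Omega>. frac_sobolev_norm s p \<Omega> (\<lambda>x. f x - g x) < ennreal \<epsilon>}"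

definition hardy_integral ::
    "real \<Rightarrow> real \<Rightarrow> 'a::euclidean_space set \<Rightarrow> ('a \<Rightarrow> real) \<Rightarrow> ennreal" where
  "hardy_integral s p \<Omega> f =
     (\<integral>\<^sup>+x. ennreal (\<bar>f x\<bar> powr p) / (bdist \<Omega> x epowr (s * p)) \<partial>lebesgue_on \<Omega>)"

definition weak_frac_hardy :: "real \<Rightarrow> real \<Rightarrow> 'a::euclidean_space set \<Rightarrow> bool" where
  "weak_frac_hardy s p \<Omega> \<longleftrightarrow>
     (\<exists>c\<ge>0. \<forall>f\<in>test_functions \<Omega>.
        hardy_integral s p \<Omega> f \<le> ennreal c * (frac_sobolev_norm s p \<Omega> f) epowr p)"

end

theory Submission
  imports Defs
begin

text \<open>All quantities are measured by \<open>p\<close>-th powers of \<open>L\<^sup>p\<close> norms. With the difference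
quotient \<open>Q f (x, y) = (f x - f y) / |x - y| powr ((d + s p) / p)\<close>, which is linear in \<open>f\<close>, the
\<open>p\<close>-th power of the Gagliardo seminorm of \<open>f\<close> is the integral of \<open>|Q f|\<close> to the \<open>p\<close> over
\<open>\<Omega> \<times> \<Omega>\<close>. So both parts of the Sobolev norm are \<open>L\<^sup>p\<close> quantities, and a statement about
\<open>L\<^sup>p\<close> on a Euclidean space applies to each of them.

Functions in the closure have a finite Hardy integral
(\<open>hardy_integral_finite_of_closure\<close>): let \<open>w\<close> be the weight \<open>d_\<Omega> powr (- s p)\<close>. On the set
where \<open>w \<le> n\<close>, a test function \<open>g\<close> satisfies
\<open>|f| powr p * w \<le> 2 powr p * (n * |f - g| powr p + |g| powr p * w)\<close>. If \<open>g\<close> is chosen close to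
\<open>f\<close>, depending on \<open>n\<close>, then the first term has integral at most 1, and the Hardy inequality
for \<open>g\<close> bounds the second one by the norm of \<open>g\<close>, hence by the norm of \<open>f\<close>. The bound
does not depend on \<open>n\<close>, and monotone convergence concludes.

Functions with a finite Hardy integral are limits of test functions
(\<open>test_functions_dense\<close>). Multiply \<open>f\<close> by cutoff functions \<open>\<theta>\<^sub>n\<close> with compact support in
\<open>\<Omega>\<close> which tend to 1 and vary on the scale of \<open>D x\<close>, the minimum of 1 and the distance of \<open>x\<close>
to the complement: \<open>|\<theta>\<^sub>n x - \<theta>\<^sub>n y| \<le> 5 min 1 (|x - y| / D x)\<close>, uniformly in \<open>n\<close>
(\<open>cutoff_variation\<close>). By scaling, the integral of
\<open>min 1 (|x - y| / r) powr p / |x - y| powr (d + s p)\<close> over \<open>y\<close> is a constant times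
\<open>r powr (- s p)\<close>, and the constant is finite because \<open>0 < s p < p\<close>
(\<open>truncated_kernel_integrable\<close>). Hence the error caused by the variation of \<open>\<theta>\<^sub>n\<close> has a
majorant that does not depend on \<open>n\<close> and whose integral is controlled by that of
\<open>|f| powr p * D powr (- s p)\<close>; this is the point where the Hardy integral enters. Dominated
convergence yields \<open>\<theta>\<^sub>n f \<rightarrow> f\<close>, and the same majorant shows that \<open>\<theta>\<^sub>n f\<close>, extended by zero,
has a finite seminorm over the whole space (\<open>product_majorant_bound\<close>,
\<open>product_majorant_integrable\<close>).

It remains to mollify a function \<open>G\<close> with compact support and finite seminorm over the whole
space (\<open>mollification_approximates\<close>). Mollification commutes with \<open>Q\<close> if \<open>Q G\<close> is averaged
over translations along the diagonal, so by Jensen's inequality the error is at most the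
modulus of continuity of translations of \<open>G\<close> and of \<open>Q G\<close> in \<open>L\<^sup>p\<close>, which tends to 0
(\<open>shift_continuous_Lp\<close>).\<close>

section \<open>Integrals of p-th powers\<close>

text \<open>The \<open>p\<close>-th power of the \<open>L\<^sup>p(A)\<close> norm; avoiding the root keeps all estimates linear in
the integrals. It is used for functions on \<open>\<Omega>\<close> and for difference quotients on \<open>\<Omega> \<times> \<Omega>\<close>.\<close>

definition Lp_mass :: "real \<Rightarrow> 'b::euclidean_space set \<Rightarrow> ('b \<Rightarrow> real) \<Rightarrow> ennreal" where
  "Lp_mass p A h = (\<integral>\<^sup>+x. ennreal (\<bar>h x\<bar> powr p) * indicator A x \<partial>lborel)"

lemma abs_add_powr_le:
  fixes a b :: real
  assumes "0 \<le> p"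
  shows "\<bar>a + b\<bar> powr p \<le> 2 powr p * (\<bar>a\<bar> powr p + \<bar>b\<bar> powr p)"
proof -
  have "\<bar>a + b\<bar> \<le> 2 * max \<bar>a\<bar> \<bar>b\<bar>" by linarith
  then have "\<bar>a + b\<bar> powr p \<le> (2 * max \<bar>a\<bar> \<bar>b\<bar>) powr p"
    using assms by (intro powr_mono2) auto
  also have "\<dots> = 2 powr p * max \<bar>a\<bar> \<bar>b\<bar> powr p" by (simp add: powr_mult)
  also have "max \<bar>a\<bar> \<bar>b\<bar> powr p \<le> \<bar>a\<bar> powr p + \<bar>b\<bar> powr p"
    by (auto simp: max_def)
  finally show ?thesis by (simp add: mult_left_mono)
qed

text \<open>A substitute for Minkowski's inequality: only smallness and finiteness of \<open>p\<close>-th powers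
matter below, so the factor \<open>2 powr p\<close> is harmless.\<close>

lemma Lp_mass_add_le:
  assumes p: "0 \<le> p" and [measurable]: "f \<in> borel_measurable borel" "g \<in> borel_measurable borel" "A \<in> sets borel"
  shows "Lp_mass p A (\<lambda>x. f x + g x) \<le> ennreal (2 powr p) * (Lp_mass p A f + Lp_mass p A g)"
proof -
  have "Lp_mass p A (\<lambda>x. f x + g x) \<le>
    (\<integral>\<^sup>+x. ennreal (2 powr p) * (ennreal (\<bar>f x\<bar> powr p) * indicator A x + ennreal (\<bar>g x\<bar> powr p) * indicator A x) \<partial>lborel)"
    unfolding Lp_mass_def
  proof (intro nn_integral_mono)
    fix x
    have "ennreal (\<bar>f x + g x\<bar> powr p) \<le> ennreal (2 powr p * (\<bar>f x\<bar> powr p + \<bar>g x\<bar> powr p))"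
      using abs_add_powr_le[OF p] by (intro ennreal_leI)
    then show "ennreal (\<bar>f x + g x\<bar> powr p) * indicator A x \<le>
      ennreal (2 powr p) * (ennreal (\<bar>f x\<bar> powr p) * indicator A x + ennreal (\<bar>g x\<bar> powr p) * indicator A x)"
      by (auto simp: indicator_def ennreal_mult)
  qed
  also have "\<dots> = ennreal (2 powr p) * (Lp_mass p A f + Lp_mass p A g)"
    unfolding Lp_mass_def by (subst nn_integral_cmult) (auto simp: nn_integral_add)
  finally show ?thesis .
qed

lemma Lp_mass_minus [simp]: "Lp_mass p A (\<lambda>x. - f x) = Lp_mass p A f"
  by (simp add: Lp_mass_def)

lemma Lp_mass_diff_le:
  assumes "0 \<le> p" "f \<in> borel_measurable borel" "g \<in> borel_measurable borel" "A \<in> sets borel"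
  shows "Lp_mass p A (\<lambda>x. f x - g x) \<le> ennreal (2 powr p) * (Lp_mass p A f + Lp_mass p A g)"
  using Lp_mass_add_le[of p f "\<lambda>x. - g x" A] assms by simp

lemma Lp_mass_commute: "Lp_mass p A (\<lambda>x. f x - g x) = Lp_mass p A (\<lambda>x. g x - f x)"
  by (simp add: Lp_mass_def abs_minus_commute)

lemma Lp_mass_mono:
  assumes "0 \<le> p" "\<And>x. x \<in> A \<Longrightarrow> \<bar>f x\<bar> \<le> \<bar>g x\<bar>"
  shows "Lp_mass p A f \<le> Lp_mass p A g"
  unfolding Lp_mass_def
  by (intro nn_integral_mono) (auto simp: indicator_def intro!: ennreal_leI powr_mono2 assms)

lemma Lp_mass_mono_set:
  assumes "A \<subseteq> B" shows "Lp_mass p A f \<le> Lp_mass p B f"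
  unfolding Lp_mass_def using assms
  by (intro nn_integral_mono) (auto simp: indicator_def)

lemma Lp_mass_tendsto_0:
  assumes p: "0 < p"
    and [measurable]: "\<And>n. u n \<in> borel_measurable borel" "w \<in> borel_measurable borel" "A \<in> sets borel"
    and bound: "\<And>n x. x \<in> A \<Longrightarrow> \<bar>u n x\<bar> powr p \<le> w x"
    and w: "(\<integral>\<^sup>+x. ennreal (w x) * indicator A x \<partial>lborel) < \<infinity>"
    and lim: "\<And>x. x \<in> A \<Longrightarrow> (\<lambda>n. u n x) \<longlonglongrightarrow> 0"
  shows "(\<lambda>n. Lp_mass p A (u n)) \<longlonglongrightarrow> 0"
proof -
  have "(\<lambda>n. Lp_mass p A (u n)) \<longlonglongrightarrow> (\<integral>\<^sup>+x. 0 \<partial>(lborel :: 'a measure))"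
    unfolding Lp_mass_def
  proof (rule nn_integral_dominated_convergence[where w="\<lambda>x. ennreal (w x) * indicator A x"])
    show "AE x in lborel. ennreal (\<bar>u j x\<bar> powr p) * indicator A x \<le> ennreal (w x) * indicator A x" for j
      using bound by (intro AE_I2) (auto simp: indicator_def intro!: ennreal_leI)
    show "AE x in lborel. (\<lambda>n. ennreal (\<bar>u n x\<bar> powr p) * indicator A x) \<longlonglongrightarrow> 0"
    proof (intro AE_I2)
      fix x
      show "(\<lambda>n. ennreal (\<bar>u n x\<bar> powr p) * indicator A x) \<longlonglongrightarrow> 0"
      proof (cases "x \<in> A")
        case True
        have "(\<lambda>n. \<bar>u n x\<bar> powr p) \<longlonglongrightarrow> 0"
          using tendsto_powr2[OF tendsto_rabs[OF lim[OF True]] tendsto_const[of p]] p by simp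
        then have "(\<lambda>n. ennreal (\<bar>u n x\<bar> powr p)) \<longlonglongrightarrow> 0"
          using tendsto_ennrealI by fastforce
        then show ?thesis using True by simp
      qed simp
    qed
  qed (use w in auto)
  then show ?thesis by simp
qed

lemma tendsto_0_le_ennreal:
  fixes g h :: "nat \<Rightarrow> ennreal"
  assumes "h \<longlonglongrightarrow> 0" "\<And>n. g n \<le> h n"
  shows "g \<longlonglongrightarrow> 0"
  by (rule tendsto_sandwich[OF _ _ tendsto_const assms(1)]) (use assms(2) in auto)


section \<open>Continuity of translations\<close>

lemma nn_integral_lborel_shift:
  assumes [measurable]: "g \<in> borel_measurable borel"
  shows "(\<integral>\<^sup>+x. g (x + a) \<partial>lborel) = (\<integral>\<^sup>+x. g x \<partial>(lborel :: 'b::euclidean_space measure))"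
proof -
  have "(\<integral>\<^sup>+x. g x \<partial>(lborel :: 'b measure)) = (\<integral>\<^sup>+x. g x \<partial>(distr lborel borel ((+) a)))"
    by (simp add: lborel_distr_plus)
  also have "\<dots> = (\<integral>\<^sup>+x. g (a + x) \<partial>lborel)" by (subst nn_integral_distr) auto
  finally show ?thesis by (simp add: add.commute)
qed

lemma Lp_mass_shift:
  assumes [measurable]: "h \<in> borel_measurable borel"
  shows "Lp_mass p UNIV (\<lambda>x. h (x + a)) = Lp_mass p UNIV h"
  unfolding Lp_mass_def
  using nn_integral_lborel_shift[of "\<lambda>x. ennreal (\<bar>h x\<bar> powr p)" a] by simp

text \<open>Continuity at 0 of the translations of \<open>h\<close> in \<open>L\<^sup>p\<close>. Sequences are used so that dominated
convergence applies directly.\<close>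

definition shift_continuous :: "real \<Rightarrow> ('b::euclidean_space \<Rightarrow> real) \<Rightarrow> bool" where
  "shift_continuous p h \<longleftrightarrow>
     (\<forall>Z. Z \<longlonglongrightarrow> 0 \<longrightarrow> (\<lambda>n. Lp_mass p UNIV (\<lambda>x. h (x + Z n) - h x)) \<longlonglongrightarrow> 0)"

text \<open>The functions with this property form a closed set, since translations are isometries:
the three differences \<open>h(\<cdot> + z) - k(\<cdot> + z)\<close>, \<open>k(\<cdot> + z) - k\<close> and \<open>k - h\<close> are all small.\<close>

lemma shift_continuous_lim:
  assumes p: "0 < p"
    and [measurable]: "h \<in> borel_measurable borel" 
    and approx: "\<And>e::real. e > 0 \<Longrightarrow> \<exists>k \<in> borel_measurable borel. shift_continuous p k \<and> Lp_mass p UNIV (\<lambda>x. k x - h x) < ennreal e"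
  shows "shift_continuous p h"
  unfolding shift_continuous_def
proof (intro allI impI tendsto_zero_ennreal)
  fix Z :: "nat \<Rightarrow> 'a" and r :: real assume Z: "Z \<longlonglongrightarrow> 0" and r: "0 < r"
  define C where "C = 2 powr p"
  have C: "C > 0" by (simp add: C_def)
  \<comment> \<open>two applications of the quasi triangle inequality lose \<open>C + 2 C\<^sup>2 \<le> 3 C\<^sup>2\<close>\<close>
  define e where "e = r / (4 * C * C)"
  have e: "e > 0" using C r by (simp add: e_def)
  obtain k where [measurable]: "k \<in> borel_measurable borel" and k: "shift_continuous p k" "Lp_mass p UNIV (\<lambda>x. k x - h x) < ennreal e"
    using approx[OF e] by blast
  have "(\<lambda>n. Lp_mass p UNIV (\<lambda>x. k (x + Z n) - k x)) \<longlonglongrightarrow> 0"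
    using k Z by (auto simp: shift_continuous_def)
  then have "\<forall>\<^sub>F n in sequentially. Lp_mass p UNIV (\<lambda>x. k (x + Z n) - k x) < ennreal e"
    using e by (auto simp: order_tendsto_iff)
  then show "\<forall>\<^sub>F n in sequentially. Lp_mass p UNIV (\<lambda>x. h (x + Z n) - h x) < ennreal r"
  proof eventually_elim
    case (elim n)
    let ?M = "Lp_mass p UNIV"
    have 1: "?M (\<lambda>x. h (x + Z n) - k (x + Z n)) = ?M (\<lambda>x. k x - h x)"
      using Lp_mass_shift[of "\<lambda>x. h x - k x" p "Z n"] using Lp_mass_commute[of p UNIV h k] by simp
    have "?M (\<lambda>x. h (x + Z n) - h x) = ?M (\<lambda>x. (h (x + Z n) - k (x + Z n)) + ((k (x + Z n) - k x) + (k x - h x)))"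
      by simp
    also have "\<dots> \<le> ennreal C * (?M (\<lambda>x. h (x + Z n) - k (x + Z n)) + ?M (\<lambda>x. (k (x + Z n) - k x) + (k x - h x)))"
      unfolding C_def using p by (intro Lp_mass_add_le) auto
    also have "\<dots> \<le> ennreal C * (?M (\<lambda>x. k x - h x) + ennreal C * (?M (\<lambda>x. k (x + Z n) - k x) + ?M (\<lambda>x. k x - h x)))"
      unfolding 1 using p unfolding C_def by (intro mult_left_mono add_left_mono Lp_mass_add_le) auto
    also have "\<dots> \<le> ennreal C * (ennreal e + ennreal C * (ennreal e + ennreal e))"
      using elim k by (intro mult_left_mono add_mono) auto
    also have "\<dots> = ennreal (C * (e + C * (e + e)))"
      using C e by (simp add: ennreal_mult mult_2[of "ennreal e"])
    also have "\<dots> < ennreal r"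
    proof (rule ennreal_lessI)
      have "C \<ge> 1" unfolding C_def using p by (simp add: ge_one_powr_ge_zero)
      then have "C * e \<le> C * C * e" using e by (simp add: mult_right_mono)
      have "C * (e + C * (e + e)) = C * e + 2 * (C * C * e)" by (simp add: algebra_simps)
      also have "\<dots> \<le> 3 * (C * C * e)" using \<open>C * e \<le> C * C * e\<close> by simp
      also have "\<dots> < r" using C r by (simp add: e_def)
      finally show "C * (e + C * (e + e)) < r" .
    qed (use r in auto)
    finally show ?case .
  qed
qed

lemma shift_continuous_add:
  assumes p: "0 < p"
    and [measurable]: "u \<in> borel_measurable borel" "v \<in> borel_measurable borel"
    and "shift_continuous p u" "shift_continuous p v"
  shows "shift_continuous p (\<lambda>x. u x + v x)"
  unfolding shift_continuous_def
proof (intro allI impI)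
  fix Z :: "nat \<Rightarrow> 'a" assume Z: "Z \<longlonglongrightarrow> 0"
  let ?M = "Lp_mass p UNIV"
  have "(\<lambda>n. ennreal (2 powr p) * (?M (\<lambda>x. u (x + Z n) - u x) + ?M (\<lambda>x. v (x + Z n) - v x))) \<longlonglongrightarrow> ennreal (2 powr p) * (0 + 0)"
    using assms(4,5) Z unfolding shift_continuous_def
    by (intro ennreal_tendsto_cmult tendsto_add) auto
  then have "(\<lambda>n. ennreal (2 powr p) * (?M (\<lambda>x. u (x + Z n) - u x) + ?M (\<lambda>x. v (x + Z n) - v x))) \<longlonglongrightarrow> 0"
    by simp
  then show "(\<lambda>n. ?M (\<lambda>x. u (x + Z n) + v (x + Z n) - (u x + v x))) \<longlonglongrightarrow> 0"
  proof (rule tendsto_0_le_ennreal)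
    show "?M (\<lambda>x. u (x + Z n) + v (x + Z n) - (u x + v x)) \<le> ennreal (2 powr p) * (?M (\<lambda>x. u (x + Z n) - u x) + ?M (\<lambda>x. v (x + Z n) - v x))" for n
      using Lp_mass_add_le[of p "\<lambda>x. u (x + Z n) - u x" "\<lambda>x. v (x + Z n) - v x" UNIV] p
      by (simp add: algebra_simps)
  qed
qed

lemma shift_continuous_cmult:
  fixes u :: "'b::euclidean_space \<Rightarrow> real"
  assumes [measurable]: "u \<in> borel_measurable borel" 
    and "shift_continuous p u"
  shows "shift_continuous p (\<lambda>x. c * u x)"
  unfolding shift_continuous_def
proof (intro allI impI)
  fix Z :: "nat \<Rightarrow> 'b" assume Z: "Z \<longlonglongrightarrow> 0"
  let ?M = "Lp_mass p UNIV"
  have "(\<lambda>n. ennreal (\<bar>c\<bar> powr p) * ?M (\<lambda>x. u (x + Z n) - u x)) \<longlonglongrightarrow> ennreal (\<bar>c\<bar> powr p) * 0"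
    using assms(2) Z unfolding shift_continuous_def
    by (intro ennreal_tendsto_cmult) auto
  moreover have "ennreal (\<bar>c\<bar> powr p) * ?M (\<lambda>x. u (x + Z n) - u x) = ?M (\<lambda>x. c * u (x + Z n) - c * u x)" for n
    unfolding Lp_mass_def
    by (subst nn_integral_cmult[symmetric])
       (auto simp: right_diff_distrib[symmetric] abs_mult powr_mult ennreal_mult)
  ultimately show "(\<lambda>n. ?M (\<lambda>x. c * u (x + Z n) - c * u x)) \<longlonglongrightarrow> 0" by simp
qed

lemma Lp_mass_indicator_diff:
  assumes [measurable]: "A \<in> sets borel" "B \<in> sets borel"
  shows "Lp_mass p UNIV (\<lambda>x. indicator A x - indicator B x) = emeasure lborel (A - B) + emeasure lborel (B - A)"
proof -
  have "Lp_mass p UNIV (\<lambda>x. indicator A x - indicator B x) = (\<integral>\<^sup>+x. indicator (A - B) x + indicator (B - A) x \<partial>lborel)"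
    unfolding Lp_mass_def by (intro nn_integral_cong) (auto simp: indicator_def)
  also have "\<dots> = emeasure lborel (A - B) + emeasure lborel (B - A)"
    by (subst nn_integral_add) auto
  finally show ?thesis .
qed

text \<open>For \<open>x\<close> in the open set \<open>U\<close> the point \<open>x + z\<close> is in \<open>U\<close> for all small \<open>z\<close>, so by dominated
convergence the part of \<open>U\<close> outside its translate has small measure. The part of the translate
outside \<open>U\<close> has the same measure, because \<open>U\<close> and its translate have equal finite measure.\<close>

lemma shift_continuous_indicator_open:
  fixes U :: "'b::euclidean_space set"
  assumes U: "open U" and fin: "emeasure lborel U < \<infinity>"
  shows "shift_continuous p (indicator U :: 'b \<Rightarrow> real)"
  unfolding shift_continuous_def
proof (intro allI impI)
  fix Z :: "nat \<Rightarrow> 'b" assume Z: "Z \<longlonglongrightarrow> 0"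
  have [measurable]: "U \<in> sets borel" using U by auto
  define V where "V n = (\<lambda>x. x + Z n) -` U" for n
  have Vo: "open (V n)" for n 
    unfolding V_def by (rule open_vimage[OF U]) (intro continuous_intros)
  have Vm[measurable]: "V n \<in> sets borel" for n using Vo by auto
  have V: "emeasure lborel (V n) = emeasure lborel U" for n
  proof -
    have "emeasure lborel (V n) = (\<integral>\<^sup>+x. indicator U (x + Z n) \<partial>lborel)"
      unfolding nn_integral_indicator[OF Vm[of n, folded sets_lborel], symmetric] by (intro nn_integral_cong) (simp add: V_def indicator_def)
    also have "\<dots> = emeasure lborel U" by (subst nn_integral_lborel_shift) auto
    finally show ?thesis .
  qed
  have eq: "emeasure lborel (V n - U) = emeasure lborel (U - V n)" for n
  proof -
    have f: "emeasure lborel (U \<inter> V n) \<noteq> \<infinity>"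
      using emeasure_mono[of "U \<inter> V n" U lborel] fin by auto
    have "emeasure lborel (V n - U) = emeasure lborel (V n) - emeasure lborel (U \<inter> V n)"
      using emeasure_Diff[of lborel "U \<inter> V n" "V n"] f by (simp add: Diff_Int2[symmetric] Int_commute) (metis Diff_Int2 Diff_Int Diff_cancel Un_empty_right)
    moreover have "emeasure lborel (U - V n) = emeasure lborel U - emeasure lborel (U \<inter> V n)"
      using emeasure_Diff[of lborel "U \<inter> V n" "U"] f by simp (metis Diff_Int Diff_cancel sup_bot_left)
    ultimately show ?thesis using V by simp
  qed
  have "(\<lambda>n. \<integral>\<^sup>+x. indicator (U - V n) x \<partial>lborel) \<longlonglongrightarrow> (\<integral>\<^sup>+x. 0 \<partial>(lborel::'b measure))"
  proof (rule nn_integral_dominated_convergence[where w="indicator U"])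
    show "AE x in lborel. (\<lambda>n. indicator (U - V n) x :: ennreal) \<longlonglongrightarrow> 0"
    proof (intro AE_I2)
      fix x
      show "(\<lambda>n. indicator (U - V n) x :: ennreal) \<longlonglongrightarrow> 0"
      proof (cases "x \<in> U")
        case True
        have "(\<lambda>n. x + Z n) \<longlonglongrightarrow> x + 0" using Z by (intro tendsto_intros)
        then have "\<forall>\<^sub>F n in sequentially. x + Z n \<in> U" using U True by (auto simp: tendsto_def)
        then have "\<forall>\<^sub>F n in sequentially. indicator (U - V n) x = (0::ennreal)"
          by eventually_elim (auto simp: V_def)
        then show ?thesis by (rule tendsto_eventually)
      qed auto
    qed
  qed (use fin in \<open>auto split: split_indicator\<close>)
  then have l: "(\<lambda>n. emeasure lborel (U - V n)) \<longlonglongrightarrow> 0" by simp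
  have "Lp_mass p UNIV (\<lambda>x. indicator U (x + Z n) - indicator U x) = emeasure lborel (U - V n) + emeasure lborel (U - V n)" for n
    using Lp_mass_indicator_diff[of "V n" U p] eq[of n]
    by (simp add: V_def indicator_def vimage_def)
  then show "(\<lambda>n. Lp_mass p UNIV (\<lambda>x. indicator U (x + Z n) - indicator U x)) \<longlonglongrightarrow> 0"
    using tendsto_add[OF l l] by simp
qed

text \<open>Outer regularity reduces a Borel set to an open set that is slightly larger in measure.\<close>

lemma shift_continuous_indicator:
  fixes A :: "'b::euclidean_space set"
  assumes p: "0 < p" and A[measurable]: "A \<in> sets borel" and fin: "emeasure lborel A < \<infinity>"
  shows "shift_continuous p (indicator A :: 'b \<Rightarrow> real)"
proof (rule shift_continuous_lim[OF p])
  fix e :: real assume e: "e > 0"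
  obtain U where U: "open U" "A \<subseteq> U" "emeasure lborel (U - A) < e"
    using outer_regular_lborel[OF A e] .
  have [measurable]: "U \<in> sets borel" using U by auto
  have "emeasure lborel U \<le> emeasure lborel A + emeasure lborel (U - A)"
    using U by (subst plus_emeasure) (auto simp: Un_absorb1)
  also have "\<dots> < \<infinity>" using fin U(3) by (auto simp: less_top intro: order.strict_trans)
  finally have "shift_continuous p (indicator U :: 'b \<Rightarrow> real)"
    using U by (intro shift_continuous_indicator_open) auto
  moreover have "Lp_mass p UNIV (\<lambda>x. indicator U x - indicator A x) < ennreal e"
    using U by (subst Lp_mass_indicator_diff) (auto simp: Diff_eq_empty_iff[THEN iffD2])
  ultimately show "\<exists>k\<in>borel_measurable borel. shift_continuous p k \<and> Lp_mass p UNIV (\<lambda>x. k x - indicator A x) < ennreal e"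
    by (intro bexI[of _ "indicator U"]) auto
qed auto

text \<open>Monotone approximation by simple functions: each approximant lies below \<open>u\<close>, and so it
converges in \<open>L\<^sup>p\<close> by dominated convergence.\<close>

lemma shift_continuous_nonneg:
  fixes u :: "'b::euclidean_space \<Rightarrow> real"
  assumes p: "0 < p" and u: "u \<in> borel_measurable lborel" "\<And>x. 0 \<le> u x" "Lp_mass p UNIV u < \<infinity>"
  shows "shift_continuous p u"
  using u
proof (induction u rule: borel_measurable_induct_real)
  case (set A)
  then have "emeasure lborel A < \<infinity>"
    using Lp_mass_indicator_diff[of A "{}" p] by simp
  then show ?case using set p by (intro shift_continuous_indicator) auto
next
  case (mult u c)
  show ?case
  proof (cases "c = 0")
    case False
    have "Lp_mass p UNIV (\<lambda>x. c * u x) = ennreal (\<bar>c\<bar> powr p) * Lp_mass p UNIV u"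
      unfolding Lp_mass_def using mult(2)
      by (subst nn_integral_cmult[symmetric]) (auto simp: abs_mult powr_mult ennreal_mult)
    then have "Lp_mass p UNIV u < \<infinity>" using mult.prems False
      by (auto simp: ennreal_mult_less_top)
    then show ?thesis using mult by (intro shift_continuous_cmult) auto
  qed (simp add: shift_continuous_def Lp_mass_def)
next
  case (add u v)
  have "Lp_mass p UNIV u \<le> Lp_mass p UNIV (\<lambda>x. v x + u x)" "Lp_mass p UNIV v \<le> Lp_mass p UNIV (\<lambda>x. v x + u x)"
    using p add by (auto intro!: Lp_mass_mono)
  then show ?case using add p by (intro shift_continuous_add) auto
next
  case (seq U)
  have le: "U n x \<le> u x" for n x
    using seq(3,4) by (intro incseq_le[of "\<lambda>n. U n x"]) (auto simp: incseq_def le_fun_def)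
  have [measurable]: "u \<in> borel_measurable borel" "U n \<in> borel_measurable borel" for n
    using seq(1) u(1) by auto
  have U: "shift_continuous p (U n)" for n
  proof (rule seq(5))
    have "Lp_mass p UNIV (U n) \<le> Lp_mass p UNIV u"
      using p seq(2) le[of n] abs_ge_self order_trans by (intro Lp_mass_mono) fastforce+
    then show "Lp_mass p UNIV (U n) < \<infinity>" using u(3) by simp
  qed
  have lim: "(\<lambda>n. Lp_mass p UNIV (\<lambda>x. U n x - u x)) \<longlonglongrightarrow> 0"
  proof (rule Lp_mass_tendsto_0[OF p, where w="\<lambda>x. \<bar>u x\<bar> powr p"])
    show "\<bar>U n x - u x\<bar> powr p \<le> \<bar>u x\<bar> powr p" for n x
      using le[of n x] seq(2)[of n x] p by (intro powr_mono2) auto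
    show "(\<lambda>n. U n x - u x) \<longlonglongrightarrow> 0" for x using seq(4) by (simp add: LIM_zero)
  qed (use u(3) in \<open>auto simp: Lp_mass_def\<close>)
  show ?case
  proof (rule shift_continuous_lim[OF p])
    fix e :: real assume "e > 0"
    then have "\<forall>\<^sub>F n in sequentially. Lp_mass p UNIV (\<lambda>x. U n x - u x) < ennreal e"
      using lim by (auto simp: order_tendsto_iff)
    then obtain n where "Lp_mass p UNIV (\<lambda>x. U n x - u x) < ennreal e"
      using eventually_happens by fastforce
    then show "\<exists>k\<in>borel_measurable borel. shift_continuous p k \<and> Lp_mass p UNIV (\<lambda>x. k x - u x) < ennreal e"
      using U by (intro bexI[of _ "U n"]) auto
  qed auto
qed

theorem shift_continuous_Lp:
  fixes h :: "'b::euclidean_space \<Rightarrow> real"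
  assumes p: "0 < p" and [measurable]: "h \<in> borel_measurable borel" and fin: "Lp_mass p UNIV h < \<infinity>"
  shows "shift_continuous p h"
proof -
  have "Lp_mass p UNIV (\<lambda>x. max 0 (h x)) \<le> Lp_mass p UNIV h" "Lp_mass p UNIV (\<lambda>x. max 0 (- h x)) \<le> Lp_mass p UNIV h"
    using p by (auto intro!: Lp_mass_mono)
  then have "shift_continuous p (\<lambda>x. max 0 (h x))" "shift_continuous p (\<lambda>x. max 0 (- h x))"
    using p fin by (auto intro!: shift_continuous_nonneg)
  then have "shift_continuous p (\<lambda>x. max 0 (h x) + (-1) * max 0 (- h x))"
    using p by (intro shift_continuous_add shift_continuous_cmult) auto
  also have "(\<lambda>x. max 0 (h x) + (-1) * max 0 (- h x)) = h" by (auto simp: max_def)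
  finally show ?thesis .
qed

section \<open>Smooth functions\<close>

abbreviation smooth :: "('a::euclidean_space \<Rightarrow> real) \<Rightarrow> bool" where
  "smooth f \<equiv> \<forall>k. times_continuously_differentiable k f"

lemma times_continuously_differentiable_SucI:
  assumes "\<And>x. (f has_derivative D x) (at x)"
    and "\<And>i. i \<in> Basis \<Longrightarrow> times_continuously_differentiable k (\<lambda>x. D x i)"
  shows "times_continuously_differentiable (Suc k) f"
proof -
  have "frechet_derivative f (at x) = D x" for x
    using frechet_derivative_at[OF assms(1)] by simp
  then show ?thesis using assms by (auto simp: differentiable_on_def differentiable_def)
qed

lemma times_continuously_differentiable_SucD:
  assumes "times_continuously_differentiable (Suc k) f"
  shows "(f has_derivative frechet_derivative f (at x)) (at x)"
    and "i \<in> Basis \<Longrightarrow> times_continuously_differentiable k (\<lambda>x. frechet_derivative f (at x) i)"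
  using assms by (auto simp: differentiable_on_def frechet_derivative_works)

lemma times_continuously_differentiable_lower:
  "times_continuously_differentiable (Suc k) f \<Longrightarrow> times_continuously_differentiable k f"
proof (induction k arbitrary: f)
  case 0
  then show ?case by (auto intro: differentiable_imp_continuous_on)
next
  case (Suc k)
  show ?case
    by (rule times_continuously_differentiable_SucI[OF times_continuously_differentiable_SucD(1)[OF Suc.prems]])
       (use times_continuously_differentiable_SucD(2)[OF Suc.prems] Suc.IH in blast)
qed

lemma smooth_continuous_on: "smooth f \<Longrightarrow> continuous_on UNIV f"
  by (metis times_continuously_differentiable.simps(1))

lemma smooth_has_derivative: "smooth f \<Longrightarrow> (f has_derivative frechet_derivative f (at x)) (at x)"
  using times_continuously_differentiable_SucD(1) by blast

lemma smooth_partial: "smooth f \<Longrightarrow> i \<in> Basis \<Longrightarrow> smooth (\<lambda>x. frechet_derivative f (at x) i)"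
  using times_continuously_differentiable_SucD(2) by blast

lemma smooth_borel_measurable: "smooth f \<Longrightarrow> f \<in> borel_measurable borel"
  using smooth_continuous_on borel_measurable_continuous_onI by blast

lemma times_continuously_differentiable_const: "times_continuously_differentiable k (\<lambda>x. c)"
proof (induction k arbitrary: c)
  case (Suc k)
  then show ?case
    by (intro times_continuously_differentiable_SucI[where D="\<lambda>x h. 0"]) (auto intro: derivative_eq_intros)
qed auto

lemma times_continuously_differentiable_add:
  "times_continuously_differentiable k f \<Longrightarrow> times_continuously_differentiable k g \<Longrightarrow>
    times_continuously_differentiable k (\<lambda>x. f x + g x)"
proof (induction k arbitrary: f g)
  case (Suc k)
  note f = times_continuously_differentiable_SucD[OF Suc.prems(1)]
  note g = times_continuously_differentiable_SucD[OF Suc.prems(2)]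
  show ?case
    by (rule times_continuously_differentiable_SucI[OF has_derivative_add[OF f(1) g(1)]])
       (intro Suc.IH f g)
qed (auto intro: continuous_intros)

lemma times_continuously_differentiable_mult:
  "times_continuously_differentiable k f \<Longrightarrow> times_continuously_differentiable k g \<Longrightarrow>
    times_continuously_differentiable k (\<lambda>x. f x * g x)"
proof (induction k arbitrary: f g)
  case (Suc k)
  note f = times_continuously_differentiable_SucD[OF Suc.prems(1)]
  note g = times_continuously_differentiable_SucD[OF Suc.prems(2)]
  show ?case
    by (rule times_continuously_differentiable_SucI[OF has_derivative_mult[OF f(1) g(1)]])
       (intro Suc.IH f g times_continuously_differentiable_add Suc.prems[THEN times_continuously_differentiable_lower])
qed (auto intro: continuous_intros)

lemma times_continuously_differentiable_inner_left:
  "times_continuously_differentiable k (\<lambda>x. x \<bullet> i)"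
proof (cases k)
  case (Suc m)
  show ?thesis unfolding Suc
    by (rule times_continuously_differentiable_SucI[where D="\<lambda>x h. h \<bullet> i"])
       (auto intro!: derivative_eq_intros times_continuously_differentiable_const)
qed (auto intro: continuous_intros)

lemma smooth_norm_square: "smooth (\<lambda>x. c - x \<bullet> x)"
proof
  fix k
  show "times_continuously_differentiable k (\<lambda>x::'a. c - x \<bullet> x)"
  proof (cases k)
    case (Suc m)
    show ?thesis unfolding Suc
    proof (rule times_continuously_differentiable_SucI[where D="\<lambda>x h. (-2) * (x \<bullet> h)"])
      show "((\<lambda>x. c - x \<bullet> x) has_derivative (\<lambda>h. - 2 * (x \<bullet> h))) (at x)" for x :: 'a
        by (auto intro!: derivative_eq_intros simp: inner_commute)
    qed (intro times_continuously_differentiable_mult times_continuously_differentiable_const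
         times_continuously_differentiable_inner_left)
  qed (auto intro!: continuous_intros)
qed

text \<open>A one-variable function enters through the sequence \<open>\<phi>\<close> of its iterated derivatives, so that
the induction on the order of differentiation can pass from \<open>\<phi> m\<close> to \<open>\<phi> (Suc m)\<close>.\<close>

lemma smooth_compose:
  fixes \<phi> :: "nat \<Rightarrow> real \<Rightarrow> real"
  assumes q: "smooth q" and \<phi>: "\<And>m t. (\<phi> m has_real_derivative \<phi> (Suc m) t) (at t)"
  shows "smooth (\<lambda>x. \<phi> m (q x))"
proof
  fix k
  show "times_continuously_differentiable k (\<lambda>x. \<phi> m (q x))"
  proof (induction k arbitrary: m)
    case 0
    have "continuous_on UNIV (\<phi> m)"
      using \<phi> by (auto intro!: DERIV_continuous_on)
    then show ?case
      using continuous_on_compose2[OF _ smooth_continuous_on[OF q]] by auto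
  next
    case (Suc k)
    have q': "times_continuously_differentiable (Suc k) q" using q by blast
    show ?case
    proof (rule times_continuously_differentiable_SucI[where D="\<lambda>x h. \<phi> (Suc m) (q x) * frechet_derivative q (at x) h"])
      show "((\<lambda>x. \<phi> m (q x)) has_derivative (\<lambda>h. \<phi> (Suc m) (q x) * frechet_derivative q (at x) h)) (at x)" for x
        using has_derivative_compose[OF smooth_has_derivative[OF q], of "\<phi> m"] \<phi>[of m "q x"]
        by (simp add: has_field_derivative_def)
    qed (intro times_continuously_differentiable_mult Suc.IH times_continuously_differentiable_SucD(2)[OF q'])
  qed
qed

section \<open>Mollifiers\<close>

text \<open>The functions \<open>P(1/t) exp(-1/t)\<close>, continued by 0 to \<open>t \<le> 0\<close>. For \<open>P = 1\<close> this is the usual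
smooth function that is flat at 0; general \<open>P\<close> make the family closed under differentiation.\<close>

definition flat :: "real poly \<Rightarrow> real \<Rightarrow> real" where
  "flat P t = (if t > 0 then poly P (inverse t) * exp (- inverse t) else 0)"

lemma poly_exp_tendsto_0: "((\<lambda>u. poly P u * exp (- u)) \<longlongrightarrow> 0) (at_top :: real filter)"
proof -
  have "((\<lambda>u. \<Sum>i\<le>degree P. coeff P i * (u ^ i / exp u)) \<longlongrightarrow> (\<Sum>i\<le>degree P. coeff P i * 0)) (at_top :: real filter)"
    by (intro tendsto_intros tendsto_power_div_exp_0)
  moreover have "(\<Sum>i\<le>degree P. coeff P i * (u ^ i / exp u)) = poly P u * exp (- u)" for u :: real
    by (simp add: poly_altdef sum_distrib_right exp_minus divide_inverse mult.assoc)
  ultimately show ?thesis by simp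
qed

text \<open>At 0 the difference quotient is again of the form \<open>R(1/t) exp(-1/t)\<close>, and the exponential
decay beats the polynomial \<open>R\<close>.\<close>

lemma flat_has_derivative:
  "(flat P has_real_derivative flat ([:0, 0, 1:] * (P - pderiv P)) t) (at t)"
proof -
  consider "t > 0" | "t < 0" | "t = 0" by linarith
  then show ?thesis
  proof cases
    case 1
    have "((\<lambda>t. poly P (inverse t) * exp (- inverse t)) has_real_derivative
      flat ([:0, 0, 1:] * (P - pderiv P)) t) (at t)"
      using 1
      by (auto intro!: derivative_eq_intros DERIV_chain2[OF poly_DERIV] simp: flat_def power2_eq_square algebra_simps)
    then show ?thesis
    proof (rule DERIV_cong_ev[THEN iffD1, rotated 3])
      show "\<forall>\<^sub>F x in nhds t. poly P (inverse x) * exp (- inverse x) = flat P x"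
        using eventually_nhds_in_open[of "{0<..}" t] 1
        by (auto simp: flat_def elim: eventually_mono)
    qed auto
  next
    case 2
    have "((\<lambda>t. 0) has_real_derivative flat ([:0, 0, 1:] * (P - pderiv P)) t) (at t)"
      using 2 by (auto simp: flat_def)
    then show ?thesis
    proof (rule DERIV_cong_ev[THEN iffD1, rotated 3])
      show "\<forall>\<^sub>F x in nhds t. 0 = flat P x"
        using eventually_nhds_in_open[of "{..<0}" t] 2
        by (auto simp: flat_def elim: eventually_mono)
    qed auto
  next
    case 3
    have "((\<lambda>h. flat P h / h) \<longlongrightarrow> 0) (at 0)"
    proof (rule filterlim_split_at)
      show "((\<lambda>h. flat P h / h) \<longlongrightarrow> 0) (at_left 0)"
        by (rule tendsto_eventually) (auto simp: flat_def eventually_at_filter)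
      have "((\<lambda>h. poly ([:0,1:] * P) (inverse h) * exp (- inverse h)) \<longlongrightarrow> 0) (at_right (0::real))"
        by (rule filterlim_compose[OF poly_exp_tendsto_0 filterlim_inverse_at_top_right])
      then show "((\<lambda>h. flat P h / h) \<longlongrightarrow> 0) (at_right 0)"
      proof (rule Lim_transform_eventually)
        show "\<forall>\<^sub>F x in at_right 0. poly ([:0, 1:] * P) (inverse x) * exp (- inverse x) = flat P x / x"
          using eventually_at_right_less[of 0]
          by eventually_elim (simp add: flat_def divide_inverse)
      qed
    qed
    then show ?thesis
      using 3 by (simp add: has_field_derivative_iff flat_def)
  qed
qed

lemma flat_derivatives:
  "\<exists>\<phi>. \<phi> 0 = flat P \<and> (\<forall>m t. (\<phi> m has_real_derivative \<phi> (Suc m) t) (at t))"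
  by (rule exI[of _ "\<lambda>m. flat (((\<lambda>P. [:0, 0, 1:] * (P - pderiv P)) ^^ m) P)"])
     (use flat_has_derivative in simp)

text \<open>Normalise \<open>exp(-1 / (e\<^sup>2 - |x|\<^sup>2))\<close>, which is positive exactly on the open ball of radius \<open>e\<close>.\<close>

lemma smooth_mollifier_exists:
  assumes e: "0 < (e::real)"
  shows "\<exists>\<rho> :: 'a::euclidean_space \<Rightarrow> real. smooth \<rho> \<and> (\<forall>x. 0 \<le> \<rho> x) \<and> (\<forall>x. \<rho> x \<noteq> 0 \<longrightarrow> norm x \<le> e) \<and>
    (\<integral>\<^sup>+x. ennreal (\<rho> x) \<partial>lborel) = 1"
proof -
  define \<beta> where "\<beta> = (\<lambda>x::'a. flat 1 (e\<^sup>2 - x \<bullet> x))"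
  obtain \<phi> where "\<phi> 0 = flat 1" "\<And>m t. (\<phi> m has_real_derivative \<phi> (Suc m) t) (at t)"
    using flat_derivatives by blast
  then have sm: "smooth \<beta>"
    using smooth_compose[OF smooth_norm_square, of \<phi> 0 "e\<^sup>2"] by (simp add: \<beta>_def)
  then have [measurable]: "\<beta> \<in> borel_measurable borel" by (rule smooth_borel_measurable)
  have nn: "0 \<le> \<beta> x" and le1: "\<beta> x \<le> 1" for x by (auto simp: \<beta>_def flat_def)
  have pos: "\<beta> x > 0 \<longleftrightarrow> norm x < e" for x
  proof -
    have "norm x < e \<longleftrightarrow> norm x ^ 2 < e ^ 2"
      using e by (metis less_imp_le norm_ge_zero pos2 power2_less_imp_less power_strict_mono)
    then show ?thesis by (auto simp: \<beta>_def flat_def power2_norm_eq_inner)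
  qed
  define c where "c = (\<integral>\<^sup>+x. ennreal (\<beta> x) \<partial>lborel)"
  have "c \<le> (\<integral>\<^sup>+x. indicator (ball (0::'a) e) x \<partial>lborel)"
    unfolding c_def
  proof (intro nn_integral_mono)
    fix x
    show "ennreal (\<beta> x) \<le> indicator (ball 0 e) x"
      using pos[of x] nn[of x] le1[of x] by (auto simp: indicator_def ennreal_le_1 ennreal_eq_0_iff)
  qed
  also have "\<dots> < top" using emeasure_lborel_ball_finite[of "0::'a" e] by simp
  finally have c1: "c < top" .
  have "c \<noteq> 0"
  proof
    assume "c = 0"
    \<comment> \<open>otherwise \<open>\<beta>\<close>, which is positive on the ball, would vanish almost everywhere\<close>
    then have "AE x in lborel. ennreal (\<beta> x) = 0"
      unfolding c_def by (subst (asm) nn_integral_0_iff_AE) auto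
    then have "AE x in lborel. x \<notin> ball (0::'a) e"
      by eventually_elim (use pos in \<open>force simp: ennreal_eq_0_iff\<close>)
    then have "emeasure lborel (ball (0::'a) e) = 0"
      by (subst (asm) AE_iff_measurable[OF _ refl]) (auto simp: ball_def)
    then show False using open_not_negligible[of "ball (0::'a) e"] e
      by (auto simp: null_sets_def negligible_iff_null_sets)
  qed
  then obtain r where r: "r > 0" "c = ennreal r"
    using c1 by (cases c) (auto simp: less_le)
  show ?thesis
  proof (intro exI[of _ "\<lambda>x. (1 / r) * \<beta> x"] conjI allI impI)
    show "times_continuously_differentiable k (\<lambda>x. (1 / r) * \<beta> x)" for k
      using sm by (intro times_continuously_differentiable_mult times_continuously_differentiable_const) auto
    have "(\<integral>\<^sup>+x. ennreal ((1 / r) * \<beta> x) \<partial>lborel) = ennreal (1 / r) * c"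
      unfolding c_def using r nn by (subst nn_integral_cmult[symmetric]) (auto simp: ennreal_mult[symmetric])
    then show "(\<integral>\<^sup>+x. ennreal ((1 / r) * \<beta> x) \<partial>lborel) = 1"
      using r by (simp add: ennreal_mult[symmetric])
    show "norm x \<le> e" if "(1 / r) * \<beta> x \<noteq> 0" for x
      using that nn[of x] pos[of x] by force
  qed (use r nn in auto)
qed

section \<open>Convolution with a smooth function\<close>

definition convolution :: "('a::euclidean_space \<Rightarrow> real) \<Rightarrow> ('a \<Rightarrow> real) \<Rightarrow> 'a \<Rightarrow> real" where
  "convolution g \<psi> x = (\<integral>y. g y * \<psi> (x - y) \<partial>lborel)"

lemma uniformly_continuous_compact_support:
  fixes \<theta> :: "'a::euclidean_space \<Rightarrow> real"
  assumes cont: "continuous_on UNIV \<theta>" and supp: "\<And>x. \<theta> x \<noteq> 0 \<Longrightarrow> norm x \<le> R"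
  shows "uniformly_continuous_on UNIV \<theta>"
  unfolding uniformly_continuous_on_def
proof (intro allI impI)
  fix e :: real assume e: "e > 0"
  have "uniformly_continuous_on (cball 0 (R + 1)) \<theta>"
    by (rule compact_uniformly_continuous) (use cont continuous_on_subset in auto)
  then obtain d where d: "d > 0" "\<And>x y. norm x \<le> R + 1 \<Longrightarrow> norm y \<le> R + 1 \<Longrightarrow> dist y x < d \<Longrightarrow> dist (\<theta> y) (\<theta> x) < e"
    using e unfolding uniformly_continuous_on_def by (metis mem_cball_0)
  show "\<exists>d>0. \<forall>x\<in>UNIV. \<forall>x'\<in>UNIV. dist x' x < d \<longrightarrow> dist (\<theta> x') (\<theta> x) < e"
  proof (intro exI[of _ "min d 1"] conjI ballI impI)
    fix x y :: 'a assume xy: "dist y x < min d 1"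
    then have n: "norm y - norm x < 1" "norm x - norm y < 1"
      using norm_triangle_ineq2[of x y] norm_triangle_ineq2[of y x] by (auto simp: dist_norm norm_minus_commute)
    show "dist (\<theta> y) (\<theta> x) < e"
    proof (cases "norm x \<le> R + 1 \<and> norm y \<le> R + 1")
      case True
      then show ?thesis using d xy by auto
    next
      case False
      then have "\<not> norm x \<le> R" "\<not> norm y \<le> R" using n by auto
      then have "\<theta> x = 0" "\<theta> y = 0" using supp by blast+
      then show ?thesis using e by simp
    qed
  qed (use d in auto)
qed

lemma bounded_compact_support:
  fixes \<theta> :: "'a::euclidean_space \<Rightarrow> real"
  assumes cont: "continuous_on UNIV \<theta>" and supp: "\<And>x. \<theta> x \<noteq> 0 \<Longrightarrow> norm x \<le> R"
  obtains B where "B > 0" "\<And>x. \<bar>\<theta> x\<bar> \<le> B"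
proof -
  have "compact (\<theta> ` cball 0 R)"
    by (rule compact_continuous_image) (use cont continuous_on_subset in auto)
  then obtain B where B: "B > 0" "\<And>x. norm x \<le> R \<Longrightarrow> \<bar>\<theta> x\<bar> \<le> B"
    using compact_imp_bounded[of "\<theta> ` cball 0 R"] unfolding bounded_pos by auto
  have "\<bar>\<theta> x\<bar> \<le> B" for x using B supp[of x] by (cases "\<theta> x = 0") auto
  then show ?thesis using B that by blast
qed

lemma integrable_convolution:
  fixes g :: "'a::euclidean_space \<Rightarrow> real"
  assumes g: "integrable lborel g" and cont: "continuous_on UNIV \<theta>" and supp: "\<And>x. \<theta> x \<noteq> 0 \<Longrightarrow> norm x \<le> R"
  shows "integrable lborel (\<lambda>y. g y * \<theta> (x - y))"
proof -
  obtain B where B: "B > 0" "\<And>x. \<bar>\<theta> x\<bar> \<le> B"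
    using bounded_compact_support[OF cont supp] by blast
  have [measurable]: "\<theta> \<in> borel_measurable borel"
    using cont by (rule borel_measurable_continuous_onI)
  show ?thesis
  proof (rule Bochner_Integration.integrable_bound[of lborel "\<lambda>y. B * g y"])
    show "AE y in lborel. norm (g y * \<theta> (x - y)) \<le> norm (B * g y)"
      using B by (intro AE_I2) (auto simp: abs_mult mult.commute[of B] intro!: mult_left_mono)
  qed (use g in auto)
qed

text \<open>A bound on the support passes to the partial derivatives; this lets the smoothness of a
convolution be proved by induction on the order of differentiation.\<close>

lemma frechet_derivative_support:
  assumes "\<And>x. \<psi> x \<noteq> 0 \<Longrightarrow> norm x \<le> R" "frechet_derivative \<psi> (at x) i \<noteq> 0"
  shows "norm x \<le> R"
proof (rule ccontr)
  assume "\<not> norm x \<le> R"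
  then have x: "x \<in> - cball 0 R" by auto
  have "((\<lambda>x. 0) has_derivative (\<lambda>h. 0)) (at x)" by simp
  then have "(\<psi> has_derivative (\<lambda>h. 0)) (at x)"
    by (rule has_derivative_transform_within_open[OF _ _ x]) (use assms(1) in force)+
  then have "frechet_derivative \<psi> (at x) = (\<lambda>h. 0)"
    using frechet_derivative_at by metis
  then show False using assms(2) by simp
qed

lemma linear_sum_Basis:
  fixes D :: "'a::euclidean_space \<Rightarrow> real"
  assumes "linear D"
  shows "D h = (\<Sum>i\<in>Basis. (h \<bullet> i) * D i)"
proof -
  have "D h = D (\<Sum>i\<in>Basis. (h \<bullet> i) *\<^sub>R i)" by (simp add: euclidean_representation)
  also have "\<dots> = (\<Sum>i\<in>Basis. (h \<bullet> i) * D i)"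
    using assms by (simp add: linear_sum linear_scale)
  finally show ?thesis .
qed

text \<open>The partial derivatives are uniformly continuous because of the compact support, so the mean
value inequality gives a remainder that is uniform in the base point. Uniformity is what
permits differentiation under the integral sign against a merely integrable function.\<close>

lemma smooth_uniformly_differentiable:
  fixes \<psi> :: "'a::euclidean_space \<Rightarrow> real"
  assumes sm: "smooth \<psi>" and supp: "\<And>x. \<psi> x \<noteq> 0 \<Longrightarrow> norm x \<le> R" and e: "e > 0"
  obtains d where "d > 0" "\<And>u h. norm h < d \<Longrightarrow>
    \<bar>\<psi> (u + h) - \<psi> u - frechet_derivative \<psi> (at u) h\<bar> \<le> e * norm h"
proof -
  let ?D = "\<lambda>u. frechet_derivative \<psi> (at u)"
  define e' where "e' = e / DIM('a)"
  have e': "e' > 0" using e by (simp add: e'_def)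
  have "\<exists>d>0. \<forall>u v. dist v u < d \<longrightarrow> \<bar>?D v i - ?D u i\<bar> < e'" if i: "i \<in> Basis" for i
  proof -
    have "uniformly_continuous_on UNIV (\<lambda>u. ?D u i)"
      using smooth_continuous_on[OF smooth_partial[OF sm i]] frechet_derivative_support[OF supp]
      by (rule uniformly_continuous_compact_support)
    from this[unfolded uniformly_continuous_on_def dist_real_def, rule_format, OF e']
    show ?thesis by simp
  qed
  then obtain d where d: "\<And>i. i \<in> Basis \<Longrightarrow> d i > 0"
    "\<And>i u v. i \<in> Basis \<Longrightarrow> dist v u < d i \<Longrightarrow> \<bar>?D v i - ?D u i\<bar> < e'"
    by metis
  define d0 where "d0 = Min (d ` (Basis :: 'a set))"
  have d0: "d0 > 0" "\<And>i. i \<in> Basis \<Longrightarrow> d0 \<le> d i" using d by (auto simp: d0_def)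
  have lin: "linear (?D u)" for u
    using smooth_has_derivative[OF sm] has_derivative_linear by blast
  show ?thesis
  proof (rule that[OF d0(1)])
    fix u h :: 'a assume h: "norm h < d0"
    have "norm (\<psi> (u + h) - \<psi> u - ?D u ((u + h) - u)) \<le> norm ((u + h) - u) * e"
    proof (rule differentiable_bound_linearization[where S="ball u d0"])
      show "u + t *\<^sub>R (u + h - u) \<in> ball u d0" if "t \<in> {0..1}" for t
      proof -
        have "norm (t *\<^sub>R h) \<le> norm h" using that by (simp add: mult_left_le_one_le)
        then show ?thesis using h by (simp add: dist_norm)
      qed
      show "(\<psi> has_derivative ?D v) (at v within ball u d0)" for v
        using smooth_has_derivative[OF sm] has_derivative_at_withinI by blast
      show "onorm (?D v - ?D u) \<le> e" if v: "v \<in> ball u d0" for v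
      proof (rule onorm_le)
        fix k :: 'a
        have "(?D v - ?D u) k = (\<Sum>i\<in>Basis. (k \<bullet> i) * (?D v i - ?D u i))"
          using linear_sum_Basis[OF lin, of v k] linear_sum_Basis[OF lin, of u k]
          by (simp add: sum_subtractf right_diff_distrib)
        also have "norm \<dots> \<le> (\<Sum>i\<in>(Basis::'a set). norm k * e')"
        proof (rule sum_norm_le)
          fix i :: 'a assume i: "i \<in> Basis"
          have "\<bar>k \<bullet> i\<bar> \<le> norm k" using Basis_le_norm[OF i] .
          moreover have "\<bar>?D v i - ?D u i\<bar> \<le> e'"
            using d(2)[OF i, of v u] d0(2)[OF i] v by (auto simp: dist_commute)
          ultimately show "norm ((k \<bullet> i) * (?D v i - ?D u i)) \<le> norm k * e'"
            by (auto simp: abs_mult intro!: mult_mono)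
        qed
        also have "\<dots> = e * norm k" by (simp add: e'_def)
        finally show "norm ((?D v - ?D u) k) \<le> e * norm k" .
      qed
      show "u \<in> ball u d0" using d0 by simp
    qed
    then show "\<bar>\<psi> (u + h) - \<psi> u - ?D u h\<bar> \<le> e * norm h" by (simp add: mult.commute)
  qed
qed

lemma convolution_has_derivative:
  fixes g :: "'a::euclidean_space \<Rightarrow> real"
  assumes g: "integrable lborel g" and sm: "smooth \<psi>" and supp: "\<And>x. \<psi> x \<noteq> 0 \<Longrightarrow> norm x \<le> R"
  shows "(convolution g \<psi> has_derivative
    (\<lambda>h. \<Sum>i\<in>Basis. (h \<bullet> i) * convolution g (\<lambda>u. frechet_derivative \<psi> (at u) i) x)) (at x)"
proof -
  let ?D = "\<lambda>u. frechet_derivative \<psi> (at u)"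
  have lin: "linear (?D u)" for u
    using smooth_has_derivative[OF sm] has_derivative_linear by blast
  have int: "integrable lborel (\<lambda>y. g y * \<psi> (x - y))" for x
    by (rule integrable_convolution[OF g smooth_continuous_on[OF sm] supp])
  have intD: "integrable lborel (\<lambda>y. g y * ?D (x - y) i)" if "i \<in> Basis" for i
    by (rule integrable_convolution[OF g smooth_continuous_on[OF smooth_partial[OF sm that]]
          frechet_derivative_support[OF supp]])
  have eqD: "(\<lambda>y. g y * ?D (x - y) h) = (\<lambda>y. \<Sum>i\<in>Basis. (h \<bullet> i) * (g y * ?D (x - y) i))" for h
  proof
    fix y show "g y * ?D (x - y) h = (\<Sum>i\<in>Basis. (h \<bullet> i) * (g y * ?D (x - y) i))"
      by (subst linear_sum_Basis[OF lin]) (simp add: sum_distrib_left mult_ac)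
  qed
  have intDh: "integrable lborel (\<lambda>y. g y * ?D (x - y) h)" for h
    unfolding eqD using intD by auto
  have sumD: "(\<Sum>i\<in>Basis. (h \<bullet> i) * convolution g (\<lambda>u. ?D u i) x) = (\<integral>y. g y * ?D (x - y) h \<partial>lborel)" for h
    unfolding eqD[of h] convolution_def using intD by (subst Bochner_Integration.integral_sum) auto
  define G where "G = (\<integral>y. \<bar>g y\<bar> \<partial>lborel)"
  have G: "G \<ge> 0" by (simp add: G_def)
  show ?thesis
    unfolding has_derivative_at_alt
  proof (intro conjI allI impI)
    show "bounded_linear (\<lambda>h. \<Sum>i\<in>Basis. (h \<bullet> i) * convolution g (\<lambda>u. ?D u i) x)"
      by (intro bounded_linear_sum bounded_linear_mult_left[THEN bounded_linear_compose] bounded_linear_inner_left)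
    fix e :: real assume e: "e > 0"
    then have "e / (G + 1) > 0" using G by simp
    from smooth_uniformly_differentiable[OF sm supp this]
    obtain d where d: "d > 0" "\<And>u h. norm h < d \<Longrightarrow> \<bar>\<psi> (u + h) - \<psi> u - ?D u h\<bar> \<le> e / (G + 1) * norm h"
      by metis
    show "\<exists>d>0. \<forall>z. norm (z - x) < d \<longrightarrow>
       norm (convolution g \<psi> z - convolution g \<psi> x - (\<Sum>i\<in>Basis. ((z - x) \<bullet> i) * convolution g (\<lambda>u. ?D u i) x)) \<le> e * norm (z - x)"
    proof (intro exI[of _ d] conjI allI impI d(1))
      fix z assume z: "norm (z - x) < d"
      define h where "h = z - x"
      have "convolution g \<psi> z - convolution g \<psi> x - (\<integral>y. g y * ?D (x - y) h \<partial>lborel)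
        = (\<integral>y. g y * \<psi> (z - y) - g y * \<psi> (x - y) - g y * ?D (x - y) h \<partial>lborel)"
        unfolding convolution_def using int intDh by simp
      also have "\<dots> = (\<integral>y. g y * (\<psi> ((x - y) + h) - \<psi> (x - y) - ?D (x - y) h) \<partial>lborel)"
        by (intro Bochner_Integration.integral_cong) (auto simp: h_def algebra_simps)
      also have "norm \<dots> \<le> (\<integral>y. \<bar>g y\<bar> * (e / (G + 1) * norm h) \<partial>lborel)"
      proof (rule order_trans[OF integral_norm_bound integral_mono])
        have "integrable lborel (\<lambda>y. g y * \<psi> (z - y) - g y * \<psi> (x - y) - g y * ?D (x - y) h)"
          using int intDh by auto
        then have "integrable lborel (\<lambda>y. g y * (\<psi> ((x - y) + h) - \<psi> (x - y) - ?D (x - y) h))"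
          by (rule Bochner_Integration.integrable_cong[THEN iffD1, rotated 2]) (auto simp: h_def algebra_simps)
        then show "integrable lborel (\<lambda>y. norm (g y * (\<psi> ((x - y) + h) - \<psi> (x - y) - ?D (x - y) h)))"
          by (rule integrable_norm)
        show "norm (g y * (\<psi> ((x - y) + h) - \<psi> (x - y) - ?D (x - y) h)) \<le> \<bar>g y\<bar> * (e / (G + 1) * norm h)" for y
          using mult_left_mono[OF d(2)[of h "x - y"], of "\<bar>g y\<bar>"] z
          by (simp add: abs_mult flip: h_def)
      qed (use g in auto)
      also have "\<dots> = G * (e / (G + 1)) * norm h" by (simp add: G_def)
      also have "\<dots> \<le> e * norm h"
      proof (rule mult_right_mono)
        show "G * (e / (G + 1)) \<le> e" using G e by (simp add: field_simps)
      qed auto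
      finally show "norm (convolution g \<psi> z - convolution g \<psi> x - (\<Sum>i\<in>Basis. ((z - x) \<bullet> i) * convolution g (\<lambda>u. ?D u i) x)) \<le> e * norm (z - x)"
        unfolding sumD h_def .
    qed
  qed
qed

theorem smooth_convolution:
  fixes g :: "'a::euclidean_space \<Rightarrow> real"
  assumes g: "integrable lborel g" and "smooth \<psi>" and "\<And>x. \<psi> x \<noteq> 0 \<Longrightarrow> norm x \<le> R"
  shows "smooth (convolution g \<psi>)"
proof
  fix k show "times_continuously_differentiable k (convolution g \<psi>)"
    using assms(2,3)
  proof (induction k arbitrary: \<psi>)
    case 0
    have "convolution g \<psi> differentiable_on UNIV"
      using convolution_has_derivative[OF g 0] by (auto simp: differentiable_on_def differentiable_def)
    then show ?case by (auto intro: differentiable_imp_continuous_on)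
  next
    case (Suc k)
    show ?case
    proof (rule times_continuously_differentiable_SucI[OF convolution_has_derivative[OF g Suc.prems]])
      fix j :: 'a assume j: "j \<in> Basis"
      have "(\<Sum>i\<in>Basis. (j \<bullet> i) * convolution g (\<lambda>u. frechet_derivative \<psi> (at u) i) x)
        = convolution g (\<lambda>u. frechet_derivative \<psi> (at u) j) x" for x
        using j by (simp add: inner_Basis if_distrib[of "\<lambda>c. c * _"] cong: if_cong)
      then show "times_continuously_differentiable k
         (\<lambda>x. \<Sum>i\<in>Basis. (j \<bullet> i) * convolution g (\<lambda>u. frechet_derivative \<psi> (at u) i) x)"
        using Suc.IH[OF smooth_partial[OF Suc.prems(1) j] frechet_derivative_support[OF Suc.prems(2)]] by simp
    qed
  qed
qed

section \<open>The truncated kernel\<close>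

lemma borel_measurable_fst_snd [measurable]:
  "fst \<in> borel_measurable (borel :: ('a::euclidean_space \<times> 'b::euclidean_space) measure)"
  "snd \<in> borel_measurable (borel :: ('a \<times> 'b) measure)"
  by (auto intro!: borel_measurable_continuous_onI continuous_intros)

lemma ball_borel [measurable]: "ball (a :: 'a::euclidean_space) r \<in> sets borel"
  by auto

text \<open>Scaling of Lebesgue measure by the factor \<open>r\<close> around the point \<open>x\<close>.\<close>

lemma nn_integral_lborel_affine:
  fixes g :: "'a::euclidean_space \<Rightarrow> ennreal"
  assumes [measurable]: "g \<in> borel_measurable borel" and r: "0 < r"
  shows "(\<integral>\<^sup>+y. g y \<partial>lborel) = ennreal (r ^ DIM('a)) * (\<integral>\<^sup>+z. g (x + r *\<^sub>R z) \<partial>lborel)"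
proof -
  have "(\<integral>\<^sup>+y. g y \<partial>lborel) = (\<integral>\<^sup>+y. g y \<partial>(density (distr lborel borel (\<lambda>z. x + r *\<^sub>R z)) (\<lambda>_. ennreal (\<bar>r\<bar> ^ DIM('a)))))"
    using lborel_affine[of r x] r by simp
  also have "\<dots> = ennreal (r ^ DIM('a)) * (\<integral>\<^sup>+z. g (x + r *\<^sub>R z) \<partial>lborel)"
    using r by (simp add: nn_integral_density nn_integral_distr nn_integral_cmult)
  finally show ?thesis .
qed

lemma emeasure_ball_scale:
  assumes r: "0 < r"
  shows "emeasure lborel (ball (0::'a::euclidean_space) r) = ennreal (r powr DIM('a)) * emeasure lborel (ball (0::'a) 1)"
proof -
  have "emeasure lborel (ball (0::'a) r) = (\<integral>\<^sup>+y. indicator (ball (0::'a) r) y \<partial>lborel)" by simp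
  also have "\<dots> = ennreal (r ^ DIM('a)) * (\<integral>\<^sup>+z. indicator (ball (0::'a) r) (0 + r *\<^sub>R z) \<partial>lborel)"
    using r by (intro nn_integral_lborel_affine) auto
  also have "(\<integral>\<^sup>+z. indicator (ball (0::'a) r) (0 + r *\<^sub>R z) \<partial>lborel) = (\<integral>\<^sup>+z. indicator (ball (0::'a) 1) z \<partial>lborel)"
    using r by (intro nn_integral_cong) (auto simp: indicator_def)
  finally show ?thesis using r by (simp add: powr_realpow)
qed

lemma dyadic_outer:
  assumes "1 \<le> (t::real)"
  obtains n :: nat where "2 powr n \<le> t" "t < 2 powr (n + 1)"
proof -
  have l: "log 2 t \<ge> 0" using assms by simp
  define n where "n = nat \<lfloor>log 2 t\<rfloor>"
  have n: "real n = of_int \<lfloor>log 2 t\<rfloor>" using l by (simp add: n_def)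
  have "2 powr n \<le> 2 powr log 2 t" unfolding n by (intro powr_mono) auto
  moreover have "2 powr log 2 t < 2 powr (n + 1)" using n by (intro powr_less_mono) linarith+
  moreover have "2 powr log 2 t = t" using assms by simp
  ultimately show ?thesis using that by auto
qed

lemma dyadic_inner:
  assumes "0 < (t::real)" "t < 1"
  obtains n :: nat where "2 powr (- real n - 1) \<le> t" "t < 2 powr (- real n)"
proof -
  have l: "log 2 t < 0" using assms by simp
  define n where "n = nat (\<lceil>- log 2 t\<rceil> - 1)"
  have n: "real n = of_int \<lceil>- log 2 t\<rceil> - 1" using l by (simp add: n_def)
  have "2 powr (- real n - 1) \<le> 2 powr log 2 t" unfolding n by (intro powr_mono) linarith+
  moreover have "2 powr log 2 t < 2 powr (- real n)" using n by (intro powr_less_mono) linarith+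
  moreover have "2 powr log 2 t = t" using assms by simp
  ultimately show ?thesis using that by auto
qed

lemma suminf_geometric_powr_finite:
  assumes "0 < a" "0 \<le> C"
  shows "(\<Sum>n. ennreal (C * 2 powr (- a * real n))) < top"
proof -
  have "2 powr (- a) < (1::real)" using assms powr_less_mono[of "-a" 0 2] by simp
  then have "summable (\<lambda>n. C * (2 powr (- a)) ^ n)" by (intro summable_mult summable_geometric) auto
  moreover have "2 powr (- a * real n) = (2 powr (- a)) ^ n" for n
    using powr_powr[of 2 "- a" "real n"] by (simp add: powr_realpow)
  ultimately have "(\<Sum>n. ennreal (C * 2 powr (- a * real n))) = ennreal (\<Sum>n. C * (2 powr (- a)) ^ n)"
    using assms by (simp add: suminf_ennreal2)
  then show ?thesis by simp
qed

text \<open>Dyadic shells: on the shell \<open>|z| \<approx> 2 powr (- n)\<close> the integral is of order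
\<open>2 powr (- n (p - s p))\<close>, and on the shell \<open>|z| \<approx> 2 powr n\<close> it is of order \<open>2 powr (- n s p)\<close>.
Both geometric series converge because \<open>0 < s p < p\<close>. Replacing shells by balls costs only
constants.\<close>

lemma truncated_kernel_integrable:
  fixes s p :: real
  assumes s: "0 < s" "s < 1" and p: "1 \<le> p"
  shows "(\<integral>\<^sup>+z. ennreal (min 1 (norm z) powr p / norm z powr (real DIM('a) + s * p)) \<partial>(lborel :: 'a::euclidean_space measure)) < top"
    (is "?I < top")
proof -
  define m where "m = real DIM('a)"
  define q where "q = m + s * p"
  have q: "q > 0" "s * p > 0" "s * p < p" using s p by (auto simp: q_def m_def intro: add_pos_pos)
  define v where "v = emeasure lborel (ball (0::'a) 1)"
  have v: "v < top" using emeasure_lborel_ball_finite[of "0::'a" 1] by (simp add: v_def)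
  \<comment> \<open>upper bounds of the kernel on the inner and on the outer dyadic shells\<close>
  define a where "a n = 2 powr (- real n * p) / 2 powr ((- real n - 1) * q)" for n
  define b where "b n = 1 / 2 powr (real n * q)" for n
  define A where "A n = (\<lambda>z::'a. ennreal (a n) * indicator (ball 0 (2 powr (- real n))) z)" for n
  define B where "B n = (\<lambda>z::'a. ennreal (b n) * indicator (ball 0 (2 powr (real n + 1))) z)" for n
  have [measurable]: "A n \<in> borel_measurable borel" "B n \<in> borel_measurable borel" for n
    unfolding A_def B_def by measurable
  have bound: "ennreal (min 1 (norm z) powr p / norm z powr q) \<le> (\<Sum>n. A n z) + (\<Sum>n. B n z)" for z :: 'a
  proof -
    consider "z = 0" | "0 < norm z" "norm z < 1" | "1 \<le> norm z" by (cases "z = 0"; cases "norm z < 1") auto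
    then show ?thesis
    proof cases
      case 2
      obtain n where n: "2 powr (- real n - 1) \<le> norm z" "norm z < 2 powr (- real n)"
        using dyadic_inner[OF 2] .
      have "min 1 (norm z) powr p / norm z powr q \<le> (2 powr (- real n)) powr p / (2 powr (- real n - 1)) powr q"
        using 2 n p q by (intro frac_le powr_mono2) auto
      also have "\<dots> = a n" by (simp add: a_def powr_powr)
      finally have "ennreal (min 1 (norm z) powr p / norm z powr q) \<le> A n z"
        using n by (simp add: A_def ennreal_leI)
      also have "A n z \<le> (\<Sum>n. A n z)"
        using sum_le_suminf[of "\<lambda>n. A n z" "{n}"] by simp
      finally show ?thesis by (rule order_trans) simp
    next
      case 3
      obtain n where n: "2 powr real n \<le> norm z" "norm z < 2 powr (real n + 1)"
        using dyadic_outer[OF 3] by (metis of_nat_1 of_nat_add)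
      have "min 1 (norm z) powr p / norm z powr q \<le> 1 / (2 powr (real n)) powr q"
        using 3 n p q by (intro frac_le powr_mono2) auto
      also have "\<dots> = b n" by (simp add: b_def powr_powr)
      finally have "ennreal (min 1 (norm z) powr p / norm z powr q) \<le> B n z"
        using n by (simp add: B_def ennreal_leI)
      also have "B n z \<le> (\<Sum>n. B n z)"
        using sum_le_suminf[of "\<lambda>n. B n z" "{n}"] by simp
      finally show ?thesis by (rule order_trans) simp
    qed (use p in simp)
  qed
  have "?I \<le> (\<integral>\<^sup>+z. (\<Sum>n. A n z) + (\<Sum>n. B n z) \<partial>lborel)"
    using bound by (intro nn_integral_mono) (simp add: q_def m_def)
  also have "\<dots> = (\<Sum>n. \<integral>\<^sup>+z. A n z \<partial>lborel) + (\<Sum>n. \<integral>\<^sup>+z. B n z \<partial>lborel)"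
    by (simp add: nn_integral_add nn_integral_suminf)
  also have "(\<lambda>n. \<integral>\<^sup>+z. A n z \<partial>lborel) = (\<lambda>n. ennreal (2 powr q * 2 powr (- (p - s * p) * real n)) * v)"
  proof
    fix n
    have "a n * (2 powr (- real n)) powr m = 2 powr q * 2 powr (- (p - s * p) * real n)"
      unfolding a_def powr_powr powr_diff[symmetric] powr_add[symmetric] by (simp add: q_def algebra_simps)
    moreover have "(\<integral>\<^sup>+z. A n z \<partial>lborel) = ennreal (a n) * emeasure lborel (ball (0::'a) (2 powr (- real n)))"
      unfolding A_def by (subst nn_integral_cmult) auto
    moreover have "emeasure lborel (ball (0::'a) (2 powr (- real n))) = ennreal ((2 powr (- real n)) powr m) * v"
      unfolding v_def m_def by (rule emeasure_ball_scale) simp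
    moreover have "ennreal (a n * (2 powr (- real n)) powr m) = ennreal (a n) * ennreal ((2 powr (- real n)) powr m)"
      by (rule ennreal_mult) (auto simp: a_def)
    ultimately show "(\<integral>\<^sup>+z. A n z \<partial>lborel) = ennreal (2 powr q * 2 powr (- (p - s * p) * real n)) * v"
      by (simp only: mult.assoc)
  qed
  also have "(\<lambda>n. \<integral>\<^sup>+z. B n z \<partial>lborel) = (\<lambda>n. ennreal (2 powr m * 2 powr (- (s * p) * real n)) * v)"
  proof
    fix n
    have "b n * (2 powr (real n + 1)) powr m = 2 powr m * 2 powr (- (s * p) * real n)"
      unfolding b_def powr_minus_divide[symmetric] powr_powr powr_diff[symmetric] powr_add[symmetric] by (simp add: q_def algebra_simps)
    moreover have "(\<integral>\<^sup>+z. B n z \<partial>lborel) = ennreal (b n) * emeasure lborel (ball (0::'a) (2 powr (real n + 1)))"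
      unfolding B_def by (subst nn_integral_cmult) auto
    moreover have "emeasure lborel (ball (0::'a) (2 powr (real n + 1))) = ennreal ((2 powr (real n + 1)) powr m) * v"
      unfolding v_def m_def by (rule emeasure_ball_scale) simp
    moreover have "ennreal (b n * (2 powr (real n + 1)) powr m) = ennreal (b n) * ennreal ((2 powr (real n + 1)) powr m)"
      by (rule ennreal_mult) (auto simp: b_def)
    ultimately show "(\<integral>\<^sup>+z. B n z \<partial>lborel) = ennreal (2 powr m * 2 powr (- (s * p) * real n)) * v"
      by (simp only: mult.assoc)
  qed
  also have "(\<Sum>n. ennreal (2 powr q * 2 powr (- (p - s * p) * real n)) * v) + (\<Sum>n. ennreal (2 powr m * 2 powr (- (s * p) * real n)) * v) < top"
  proof -
    have fin: "x * v < top" if "x < top" for x :: ennreal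
      using that v by (simp add: ennreal_mult_less_top)
    show ?thesis
      unfolding ennreal_suminf_multc less_top[symmetric] ennreal_add_eq_top de_Morgan_disj
      using fin[OF suminf_geometric_powr_finite[of "p - s * p" "2 powr q"]]
        fin[OF suminf_geometric_powr_finite[of "s * p" "2 powr m"]] q
      by (simp only: less_top diff_gt_0_iff_gt powr_ge_zero simp_thms)
  qed
  finally show ?thesis .
qed

text \<open>The type argument carries the dimension, which the value depends on.\<close>

definition kernel_const :: "real \<Rightarrow> real \<Rightarrow> 'a::euclidean_space itself \<Rightarrow> ennreal" where
  "kernel_const s p _ = (\<integral>\<^sup>+z. ennreal (min 1 (norm z) powr p / norm z powr (real DIM('a) + s * p)) \<partial>(lborel :: 'a measure))"

text \<open>Substitute \<open>y = x + r z\<close>: the volume element contributes \<open>r powr d\<close> and the denominator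
\<open>r powr (- (d + s p))\<close>.\<close>

lemma truncated_kernel_integral:
  fixes x :: "'a::euclidean_space"
  assumes r: "0 < r"
  shows "(\<integral>\<^sup>+y. ennreal (min 1 (norm (x - y) / r) powr p / norm (x - y) powr (real DIM('a) + s * p)) \<partial>lborel)
    = kernel_const s p TYPE('a) * ennreal (r powr (- (s * p)))"
proof -
  define q where "q = real DIM('a) + s * p"
  have "(\<integral>\<^sup>+y. ennreal (min 1 (norm (x - y) / r) powr p / norm (x - y) powr q) \<partial>lborel)
    = ennreal (r ^ DIM('a)) * (\<integral>\<^sup>+z. ennreal (min 1 (norm (x - (x + r *\<^sub>R z)) / r) powr p / norm (x - (x + r *\<^sub>R z)) powr q) \<partial>(lborel :: 'a measure))"
    using r by (intro nn_integral_lborel_affine) auto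
  also have "(\<lambda>z::'a. ennreal (min 1 (norm (x - (x + r *\<^sub>R z)) / r) powr p / norm (x - (x + r *\<^sub>R z)) powr q))
    = (\<lambda>z. ennreal (r powr (- q)) * ennreal (min 1 (norm z) powr p / norm z powr q))"
    using r by (auto simp: powr_mult powr_minus_divide ennreal_mult[symmetric])
  also have "ennreal (r ^ DIM('a)) * (\<integral>\<^sup>+z. ennreal (r powr (- q)) * ennreal (min 1 (norm z) powr p / norm z powr q) \<partial>(lborel :: 'a measure))
    = ennreal (r ^ DIM('a) * r powr (- q)) * kernel_const s p TYPE('a)"
    using r by (simp add: nn_integral_cmult kernel_const_def q_def ennreal_mult mult.assoc)
  also have "r ^ DIM('a) * r powr (- q) = r powr (- (s * p))"
    using r by (simp add: powr_realpow[symmetric] powr_add[symmetric] q_def)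
  finally show ?thesis by (simp add: q_def mult.commute)
qed

section \<open>Cutoff functions\<close>

text \<open>The distance to the complement, truncated at 1. It vanishes outside \<open>\<Omega>\<close>, is Lipschitz on the
whole space, and is positive and finite on \<open>\<Omega>\<close> even if \<open>\<Omega>\<close> has no boundary.\<close>

definition complement_dist :: "'a::euclidean_space set \<Rightarrow> 'a \<Rightarrow> real" where
  "complement_dist \<Omega> x = (if \<Omega> = UNIV then 1 else min 1 (infdist x (- \<Omega>)))"

lemma complement_dist_props:
  shows "complement_dist \<Omega> x \<le> 1" "0 \<le> complement_dist \<Omega> x"
    and "\<bar>complement_dist \<Omega> x - complement_dist \<Omega> y\<bar> \<le> norm (x - y)"
    and "x \<notin> \<Omega> \<Longrightarrow> complement_dist \<Omega> x = 0"
    and "continuous_on UNIV (complement_dist \<Omega>)"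
    and "open \<Omega> \<Longrightarrow> x \<in> \<Omega> \<Longrightarrow> 0 < complement_dist \<Omega> x"
proof -
  show "complement_dist \<Omega> x \<le> 1" "0 \<le> complement_dist \<Omega> x"
    by (auto simp: complement_dist_def infdist_nonneg)
  show "\<bar>complement_dist \<Omega> x - complement_dist \<Omega> y\<bar> \<le> norm (x - y)"
    using infdist_triangle_abs[of x "- \<Omega>" y] by (auto simp: complement_dist_def dist_norm min_def)
  show "x \<notin> \<Omega> \<Longrightarrow> complement_dist \<Omega> x = 0" by (auto simp: complement_dist_def)
  show "continuous_on UNIV (complement_dist \<Omega>)"
    unfolding complement_dist_def by (cases "\<Omega> = UNIV") (auto intro!: continuous_intros)
  show "0 < complement_dist \<Omega> x" if "open \<Omega>" "x \<in> \<Omega>"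
  proof (cases "\<Omega> = UNIV")
    case False
    then have "- \<Omega> \<noteq> {}" by auto
    then have "infdist x (- \<Omega>) \<noteq> 0"
      using that in_closed_iff_infdist_zero[of "- \<Omega>" x] by auto
    then show ?thesis using False infdist_nonneg[of x "- \<Omega>"] by (simp add: complement_dist_def)
  qed (simp add: complement_dist_def)
qed

lemma clamp_lipschitz:
  fixes a b :: real
  shows "\<bar>max 0 (min 1 a) - max 0 (min 1 b)\<bar> \<le> min 1 \<bar>a - b\<bar>"
  by (auto simp: max_def min_def)

lemma abs_mult_diff_le:
  fixes a b a' b' :: real
  assumes "0 \<le> a" "a \<le> 1" "0 \<le> b'" "b' \<le> 1"
  shows "\<bar>a * b - a' * b'\<bar> \<le> \<bar>a - a'\<bar> + \<bar>b - b'\<bar>"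
proof -
  have "a * b - a' * b' = a * (b - b') + (a - a') * b'" by (simp add: algebra_simps)
  then have "\<bar>a * b - a' * b'\<bar> \<le> \<bar>a\<bar> * \<bar>b - b'\<bar> + \<bar>a - a'\<bar> * \<bar>b'\<bar>"
    by (metis abs_mult abs_triangle_ineq)
  also have "\<dots> \<le> 1 * \<bar>b - b'\<bar> + \<bar>a - a'\<bar> * 1"
    using assms by (intro add_mono mult_mono) auto
  finally show ?thesis by simp
qed

text \<open>The first factor removes a neighbourhood of the complement, where the truncated distance is at
most \<open>1 / (n + 1)\<close>; the second one makes the support bounded.\<close>

definition cutoff :: "'a::euclidean_space set \<Rightarrow> nat \<Rightarrow> 'a \<Rightarrow> real" where
  "cutoff \<Omega> n x = max 0 (min 1 (real (Suc n) * complement_dist \<Omega> x - 1)) * max 0 (min 1 (2 - norm x / real (Suc n)))"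

lemma cutoff_continuous: "continuous_on UNIV (cutoff \<Omega> n)"
  unfolding cutoff_def by (intro continuous_intros complement_dist_props) auto

lemma cutoff_range: "0 \<le> cutoff \<Omega> n x" "cutoff \<Omega> n x \<le> 1"
  unfolding cutoff_def by (auto intro!: mult_le_one)

lemma cutoff_support:
  "\<exists>K. compact K \<and> K \<subseteq> \<Omega> \<and> (\<forall>x. cutoff \<Omega> n x \<noteq> 0 \<longrightarrow> x \<in> K)"
proof (intro exI conjI allI impI)
  let ?K = "{x. 1 / real (Suc n) \<le> complement_dist \<Omega> x} \<inter> cball 0 (2 * real (Suc n))"
  have "closed {x. 1 / real (Suc n) \<le> complement_dist \<Omega> x}"
    by (intro closed_Collect_le continuous_intros complement_dist_props)
  then show "compact ?K" by (intro closed_Int_compact) auto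
  show "?K \<subseteq> \<Omega>"
  proof
    fix x assume "x \<in> ?K"
    then have "complement_dist \<Omega> x \<ge> 1 / real (Suc n)" by auto
    moreover have "1 / real (Suc n) > 0" by simp
    ultimately have "complement_dist \<Omega> x \<noteq> 0" by linarith
    then show "x \<in> \<Omega>" using complement_dist_props(4) by blast
  qed
  fix x assume "cutoff \<Omega> n x \<noteq> 0"
  then have "max 0 (min 1 (real (Suc n) * complement_dist \<Omega> x - 1)) \<noteq> 0" "max 0 (min 1 (2 - norm x / real (Suc n))) \<noteq> 0"
    unfolding cutoff_def by auto
  moreover have "a > 0" if "max 0 (min 1 a) \<noteq> 0" for a :: real
    using that by (auto simp: max_def min_def split: if_splits)
  ultimately have "real (Suc n) * complement_dist \<Omega> x - 1 > 0" "2 - norm x / real (Suc n) > 0"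
    by blast+
  then show "x \<in> ?K" by (auto simp: field_simps)
qed

lemma cutoff_tendsto:
  assumes "open \<Omega>" "x \<in> \<Omega>"
  shows "(\<lambda>n. cutoff \<Omega> n x) \<longlonglongrightarrow> 1"
proof (rule tendsto_eventually)
  have D: "complement_dist \<Omega> x > 0" using complement_dist_props assms by blast
  obtain N :: nat where N: "real N \<ge> max (2 / complement_dist \<Omega> x) (norm x)" using real_arch_simple by blast
  show "\<forall>\<^sub>F n in sequentially. cutoff \<Omega> n x = 1"
    using eventually_ge_at_top[of N]
  proof eventually_elim
    case (elim n)
    then have n: "real (Suc n) \<ge> 2 / complement_dist \<Omega> x" "real (Suc n) \<ge> norm x" using N by auto
    have "real (Suc n) * complement_dist \<Omega> x - 1 \<ge> 1" using n(1) D by (simp add: field_simps)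
    moreover have "2 - norm x / real (Suc n) \<ge> 1" using n(2) by (simp add: field_simps)
    ultimately show ?case by (simp add: cutoff_def)
  qed
qed

text \<open>The first factor changes only where the truncated distance is between \<open>1 / k\<close> and \<open>2 / k\<close>
for \<open>k = n + 1\<close>. So if \<open>y\<close> is closer to \<open>x\<close> than half of \<open>D x\<close> and the values at \<open>x\<close> and \<open>y\<close>
differ, then \<open>D x \<le> 4 / k\<close>, and the Lipschitz constant \<open>k\<close> is at most \<open>4 / D x\<close>. For the other
\<open>y\<close> the right-hand side is already large. The second factor has Lipschitz constant
\<open>1 / k \<le> 1 \<le> 1 / D x\<close>.\<close>

lemma cutoff_variation:
  assumes "open \<Omega>" "x \<in> \<Omega>"
  shows "\<bar>cutoff \<Omega> n x - cutoff \<Omega> n y\<bar> \<le> 5 * min 1 (norm (x - y) / complement_dist \<Omega> x)"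
proof -
  let ?D = "complement_dist \<Omega>" and ?k = "real (Suc n)"
  define M where "M = min 1 (norm (x - y) / ?D x)"
  have D: "0 < ?D x" "?D x \<le> 1" using complement_dist_props assms by blast+
  have M0: "0 \<le> M" using D by (auto simp: M_def)
  have b: "\<bar>max 0 (min 1 (2 - norm x / ?k)) - max 0 (min 1 (2 - norm y / ?k))\<bar> \<le> M"
  proof -
    have "\<bar>(2 - norm x / ?k) - (2 - norm y / ?k)\<bar> = \<bar>norm x - norm y\<bar> / ?k"
      by (simp add: diff_divide_distrib[symmetric] abs_minus_commute)
    also have "\<dots> \<le> norm (x - y) / ?D x"
      using D norm_triangle_ineq3[of x y] by (intro frac_le) auto
    finally show ?thesis using clamp_lipschitz[of "2 - norm x / ?k" "2 - norm y / ?k"] by (auto simp: M_def)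
  qed
  have a: "\<bar>max 0 (min 1 (?k * ?D x - 1)) - max 0 (min 1 (?k * ?D y - 1))\<bar> \<le> 4 * M" (is "?L \<le> _")
  proof (cases "norm (x - y) < ?D x / 2")
    case False
    then have "M \<ge> 1 / 2" using D by (auto simp: M_def field_simps)
    then show ?thesis using clamp_lipschitz[of "?k * ?D x - 1" "?k * ?D y - 1"] by linarith
  next
    case True
    have diff: "\<bar>?D x - ?D y\<bar> \<le> norm (x - y)" by (rule complement_dist_props)
    show ?thesis
    proof (cases "?D x > 4 / ?k")
      case True
      have "?D y \<ge> ?D x / 2" using diff \<open>norm (x - y) < ?D x / 2\<close> by linarith
      moreover have "?D x / 2 \<ge> 2 / ?k" using True by simp
      ultimately have "?D y \<ge> 2 / ?k" by linarith
      then have "?k * ?D x - 1 \<ge> 1" "?k * ?D y - 1 \<ge> 1" using True by (auto simp: field_simps)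
      then have "?L = 0" by (simp add: min_def)
      then show ?thesis using M0 by linarith
    next
      case F: False
      then have k: "?k \<le> 4 / ?D x" using D by (simp add: field_simps)
      have "?L \<le> \<bar>(?k * ?D x - 1) - (?k * ?D y - 1)\<bar>"
        using clamp_lipschitz[of "?k * ?D x - 1" "?k * ?D y - 1"] by linarith
      also have "\<dots> = ?k * \<bar>?D x - ?D y\<bar>" by (simp add: right_diff_distrib[symmetric] abs_mult del: of_nat_Suc)
      also have "\<dots> \<le> (4 / ?D x) * norm (x - y)" using k diff D by (intro mult_mono) auto
      also have "\<dots> = 4 * M" using True D by (simp add: M_def min_def field_simps)
      finally show ?thesis .
    qed
  qed
  have "\<bar>cutoff \<Omega> n x - cutoff \<Omega> n y\<bar> \<le> 4 * M + M"
    unfolding cutoff_def by (rule order_trans[OF abs_mult_diff_le add_mono[OF a b]]) auto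
  then show ?thesis by (simp add: M_def)
qed

section \<open>Difference quotients of products\<close>

text \<open>The exponent is chosen such that the \<open>p\<close>-th power of the quotient is the integrand of the
Gagliardo seminorm.\<close>

definition gagliardo_quotient :: "real \<Rightarrow> real \<Rightarrow> ('a::euclidean_space \<Rightarrow> real) \<Rightarrow> 'a \<times> 'a \<Rightarrow> real" where
  "gagliardo_quotient s p F = (\<lambda>w. (F (fst w) - F (snd w)) / norm (fst w - snd w) powr ((real DIM('a) + s * p) / p))"

lemma gagliardo_quotient_measurable [measurable]:
  assumes [measurable]: "F \<in> borel_measurable borel"
  shows "gagliardo_quotient s p F \<in> borel_measurable borel"
  unfolding gagliardo_quotient_def by measurable

lemma gagliardo_quotient_powr:
  fixes F :: "'a::euclidean_space \<Rightarrow> real"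
  assumes "0 < p"
  shows "\<bar>gagliardo_quotient s p F (x, y)\<bar> powr p = \<bar>F x - F y\<bar> powr p / norm (x - y) powr (real DIM('a) + s * p)"
  using assms by (simp add: gagliardo_quotient_def powr_divide powr_powr)

lemma gagliardo_quotient_diff:
  "gagliardo_quotient s p (\<lambda>x. F x - G x) w = gagliardo_quotient s p F w - gagliardo_quotient s p G w"
  by (simp add: gagliardo_quotient_def diff_divide_distrib)

text \<open>A bound, free of the cutoff, for the quotient of the product of \<open>F\<close> with a cutoff: the
variation of \<open>F\<close> inside \<open>\<Omega>\<close>, plus one term for the variation of the cutoff at each of the two
points, where \<open>F\<close> enters only through its size.\<close>

definition product_majorant :: "real \<Rightarrow> real \<Rightarrow> 'a::euclidean_space set \<Rightarrow> ('a \<Rightarrow> real) \<Rightarrow> 'a \<times> 'a \<Rightarrow> real" where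
  "product_majorant s p \<Omega> F = (\<lambda>(x, y).
     let N = norm (x - y); \<kappa> = (\<lambda>u. 5 powr p * (\<bar>F u\<bar> powr p * (min 1 (N / complement_dist \<Omega> u) powr p / N powr (real DIM('a) + s * p))))
     in 2 powr p * (\<bar>gagliardo_quotient s p F (x, y)\<bar> powr p * indicator (\<Omega> \<times> \<Omega>) (x, y) + (\<kappa> x + \<kappa> y)))"

text \<open>Inside \<open>\<Omega>\<close> use
\<open>\<tau> x * F x - \<tau> y * F y = \<tau> y * (F x - F y) + F x * (\<tau> x - \<tau> y)\<close>. If one point lies outside, then
\<open>F\<close> vanishes there, and if \<open>\<tau>\<close> vanishes there as well, then only the second kind of term is
left. The case distinction in the last assumption covers two uses: \<open>\<tau> = 1 - \<theta>\<close> on \<open>\<Omega> \<times> \<Omega>\<close>, and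
\<open>\<tau> = \<theta>\<close> on the whole space.\<close>

lemma product_majorant_bound:
  fixes F \<tau> :: "'a::euclidean_space \<Rightarrow> real"
  assumes p: "1 \<le> p" and F: "\<And>x. x \<notin> \<Omega> \<Longrightarrow> F x = 0"
    and \<tau>: "\<And>x. 0 \<le> \<tau> x" "\<And>x. \<tau> x \<le> 1"
    and var: "\<And>x y. x \<in> \<Omega> \<Longrightarrow> \<bar>\<tau> x - \<tau> y\<bar> \<le> 5 * min 1 (norm (x - y) / complement_dist \<Omega> x)"
    and xy: "x \<in> \<Omega> \<and> y \<in> \<Omega> \<or> (\<forall>u. u \<notin> \<Omega> \<longrightarrow> \<tau> u = 0)"
  shows "\<bar>gagliardo_quotient s p (\<lambda>x. \<tau> x * F x) (x, y)\<bar> powr p \<le> product_majorant s p \<Omega> F (x, y)"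
proof -
  define N where "N = norm (x - y)"
  define q where "q = real DIM('a) + s * p"
  define \<kappa> where "\<kappa> u = 5 powr p * (\<bar>F u\<bar> powr p * (min 1 (N / complement_dist \<Omega> u) powr p / N powr q))" for u
  have \<kappa>0: "0 \<le> \<kappa> u" for u by (simp add: \<kappa>_def)
  have key: "\<bar>F u * (\<tau> x - \<tau> y)\<bar> powr p / N powr q \<le> \<kappa> u" if u: "u \<in> \<Omega>" "u = x \<or> u = y" for u
  proof -
    have "\<bar>\<tau> x - \<tau> y\<bar> \<le> 5 * min 1 (N / complement_dist \<Omega> u)"
      using var[of x y] var[of y x] u unfolding N_def by (auto simp: norm_minus_commute abs_minus_commute)
    then have "\<bar>F u * (\<tau> x - \<tau> y)\<bar> powr p \<le> (\<bar>F u\<bar> * (5 * min 1 (N / complement_dist \<Omega> u))) powr p"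
      using p unfolding abs_mult by (intro powr_mono2 mult_left_mono) auto
    also have "\<dots> = 5 powr p * (\<bar>F u\<bar> powr p * min 1 (N / complement_dist \<Omega> u) powr p)"
      by (simp add: powr_mult N_def complement_dist_props)
    finally have "\<bar>F u * (\<tau> x - \<tau> y)\<bar> powr p / N powr q \<le> 5 powr p * (\<bar>F u\<bar> powr p * min 1 (N / complement_dist \<Omega> u) powr p) / N powr q"
      by (intro divide_right_mono) auto
    then show ?thesis by (simp add: \<kappa>_def)
  qed
  have two: "1 \<le> 2 powr p" using p by (simp add: ge_one_powr_ge_zero)
  let ?Q = "\<bar>\<tau> x * F x - \<tau> y * F y\<bar> powr p / N powr q"
  let ?R = "\<bar>F x - F y\<bar> powr p / N powr q"
  have "?Q \<le> 2 powr p * (?R * indicator (\<Omega> \<times> \<Omega>) (x, y) + (\<kappa> x + \<kappa> y))"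
  proof (cases "x \<in> \<Omega> \<and> y \<in> \<Omega>")
    case True
    have "\<tau> x * F x - \<tau> y * F y = \<tau> y * (F x - F y) + F x * (\<tau> x - \<tau> y)" by (simp add: algebra_simps)
    then have "\<bar>\<tau> x * F x - \<tau> y * F y\<bar> powr p \<le> 2 powr p * (\<bar>\<tau> y * (F x - F y)\<bar> powr p + \<bar>F x * (\<tau> x - \<tau> y)\<bar> powr p)"
      using abs_add_powr_le[of p] p by simp
    also have "\<bar>\<tau> y * (F x - F y)\<bar> powr p \<le> \<bar>F x - F y\<bar> powr p"
      using p \<tau>[of y] by (intro powr_mono2) (auto simp: abs_mult mult_left_le_one_le)
    finally have "\<bar>\<tau> x * F x - \<tau> y * F y\<bar> powr p \<le> 2 powr p * (\<bar>F x - F y\<bar> powr p + \<bar>F x * (\<tau> x - \<tau> y)\<bar> powr p)"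
      by simp
    then have "?Q \<le> 2 powr p * (\<bar>F x - F y\<bar> powr p + \<bar>F x * (\<tau> x - \<tau> y)\<bar> powr p) / N powr q"
      by (intro divide_right_mono) auto
    also have "\<dots> = 2 powr p * (?R + \<bar>F x * (\<tau> x - \<tau> y)\<bar> powr p / N powr q)"
      by (simp add: add_divide_distrib distrib_left)
    also have "\<dots> \<le> 2 powr p * (?R + (\<kappa> x + \<kappa> y))"
      using key[of x] \<kappa>0[of y] True by (intro mult_left_mono) auto
    finally show ?thesis using True by simp
  next
    case False
    then have \<tau>0: "\<tau> u = 0" if "u \<notin> \<Omega>" for u using xy that by blast
    have "?Q \<le> \<kappa> x + \<kappa> y"
    proof (cases "x \<in> \<Omega> \<or> y \<in> \<Omega>")
      case True
      then consider "x \<in> \<Omega>" "y \<notin> \<Omega>" | "x \<notin> \<Omega>" "y \<in> \<Omega>" using False by blast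
      then show ?thesis
      proof cases
        case 1
        then show ?thesis using key[of x] \<kappa>0[of y] \<tau>0[of y] by (simp add: mult.commute)
      next
        case 2
        then show ?thesis using key[of y] \<kappa>0[of x] \<tau>0[of x] by (simp add: mult.commute)
      qed
    next
      case False
      then show ?thesis using \<kappa>0 F p by simp
    qed
    also have "\<dots> \<le> 2 powr p * (\<kappa> x + \<kappa> y)"
      using mult_right_mono[OF two, of "\<kappa> x + \<kappa> y"] \<kappa>0 by simp
    finally show ?thesis using False by (auto simp: indicator_def)
  qed
  then show ?thesis
    using p by (simp add: gagliardo_quotient_powr product_majorant_def N_def q_def \<kappa>_def Let_def)
qed

lemma complement_dist_measurable [measurable]: "complement_dist \<Omega> \<in> borel_measurable borel"
  using complement_dist_props(5) by (rule borel_measurable_continuous_onI)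

lemma product_majorant_measurable [measurable]:
  assumes [measurable]: "F \<in> borel_measurable borel" "\<Omega> \<in> sets borel"
  shows "product_majorant s p \<Omega> F \<in> borel_measurable borel"
proof -
  have [measurable]: "\<Omega> \<times> \<Omega> \<in> sets borel" by (intro borel_Times) auto
  show ?thesis unfolding product_majorant_def Let_def case_prod_beta prod.collapse by measurable
qed

text \<open>Integrating the kernel over the second variable turns the variation terms into the integral of
\<open>|F| powr p\<close> with the weight \<open>D powr (- s p)\<close>.\<close>

lemma product_majorant_integrable:
  fixes F :: "'a::euclidean_space \<Rightarrow> real"
  assumes s: "0 < s" "s < 1" and p: "1 \<le> p" and \<Omega>: "open \<Omega>" 
    and [measurable]: "F \<in> borel_measurable borel" and F: "\<And>x. x \<notin> \<Omega> \<Longrightarrow> F x = 0"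
    and S: "Lp_mass p (\<Omega> \<times> \<Omega>) (gagliardo_quotient s p F) < top"
    and H: "(\<integral>\<^sup>+x. ennreal (\<bar>F x\<bar> powr p * complement_dist \<Omega> x powr (- (s * p))) \<partial>lborel) < top"
  shows "(\<integral>\<^sup>+w. ennreal (product_majorant s p \<Omega> F w) \<partial>lborel) < top"
proof -
  have [measurable]: "\<Omega> \<in> sets borel" using \<Omega> by auto
  have [measurable]: "\<Omega> \<times> \<Omega> \<in> sets borel" by (intro borel_Times) auto
  let ?q = "real DIM('a) + s * p"
  define k where "k = (\<lambda>(u::'a) (v::'a). \<bar>F u\<bar> powr p * (min 1 (norm (u - v) / complement_dist \<Omega> u) powr p / norm (u - v) powr ?q))"
  have [measurable]: "(\<lambda>w. k (fst w) (snd w)) \<in> borel_measurable borel" "(\<lambda>w. k (snd w) (fst w)) \<in> borel_measurable borel"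
    "k u \<in> borel_measurable borel" for u
    unfolding k_def by measurable
  have inner: "(\<integral>\<^sup>+v. ennreal (k u v) \<partial>lborel) = kernel_const s p TYPE('a) * ennreal (\<bar>F u\<bar> powr p * complement_dist \<Omega> u powr (- (s * p)))" for u
  proof (cases "u \<in> \<Omega>")
    case True
    then have D: "0 < complement_dist \<Omega> u" using complement_dist_props \<Omega> by blast
    have "(\<integral>\<^sup>+v. ennreal (k u v) \<partial>lborel) = ennreal (\<bar>F u\<bar> powr p) * (\<integral>\<^sup>+v. ennreal (min 1 (norm (u - v) / complement_dist \<Omega> u) powr p / norm (u - v) powr ?q) \<partial>lborel)"
    proof -
      have "ennreal (k u v) = ennreal (\<bar>F u\<bar> powr p) * ennreal (min 1 (norm (u - v) / complement_dist \<Omega> u) powr p / norm (u - v) powr ?q)" for v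
        unfolding k_def by (rule ennreal_mult) auto
      then show ?thesis by (simp add: nn_integral_cmult)
    qed
    also have "\<dots> = kernel_const s p TYPE('a) * ennreal (\<bar>F u\<bar> powr p * complement_dist \<Omega> u powr (- (s * p)))"
      by (subst truncated_kernel_integral[OF D]) (auto simp: ennreal_mult mult_ac)
    finally show ?thesis .
  next
    case False
    then show ?thesis using F p by (simp add: k_def)
  qed
  have I: "(\<integral>\<^sup>+u. \<integral>\<^sup>+v. ennreal (k u v) \<partial>lborel \<partial>lborel) < top"
    unfolding inner using H truncated_kernel_integrable[where 'a='a, OF s p]
    by (subst nn_integral_cmult) (auto simp: kernel_const_def ennreal_mult_less_top)
  have I1: "(\<integral>\<^sup>+w. ennreal (k (fst w) (snd w)) \<partial>lborel) < top"
    using I lborel.nn_integral_fst[of "\<lambda>w. ennreal (k (fst w) (snd w))" "lborel :: 'a measure"]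
    unfolding lborel_prod by (simp add: borel_prod)
  have I2: "(\<integral>\<^sup>+w. ennreal (k (snd w) (fst w)) \<partial>lborel) < top"
    using I lborel_pair.nn_integral_snd[of "\<lambda>w. ennreal (k (snd w) (fst w))"]
    unfolding lborel_prod by (simp add: borel_prod split_beta')
  have "ennreal (product_majorant s p \<Omega> F w) = ennreal (2 powr p) * ((ennreal (\<bar>gagliardo_quotient s p F w\<bar> powr p) * indicator (\<Omega> \<times> \<Omega>) w
     + (ennreal (5 powr p) * ennreal (k (fst w) (snd w)) + ennreal (5 powr p) * ennreal (k (snd w) (fst w)))))" for w
  proof -
    have k0: "0 \<le> k u v" for u v by (simp add: k_def)
    have "product_majorant s p \<Omega> F w = 2 powr p * ((\<bar>gagliardo_quotient s p F w\<bar> powr p) * indicator (\<Omega> \<times> \<Omega>) w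
       + (5 powr p * k (fst w) (snd w) + 5 powr p * k (snd w) (fst w)))"
      by (cases w) (simp add: product_majorant_def Let_def k_def norm_minus_commute)
    then show ?thesis using k0 by (simp add: ennreal_mult ennreal_indicator)
  qed
  then have "(\<integral>\<^sup>+w. ennreal (product_majorant s p \<Omega> F w) \<partial>lborel) =
    ennreal (2 powr p) * (Lp_mass p (\<Omega> \<times> \<Omega>) (gagliardo_quotient s p F) +
     (ennreal (5 powr p) * (\<integral>\<^sup>+w. ennreal (k (fst w) (snd w)) \<partial>lborel) + ennreal (5 powr p) * (\<integral>\<^sup>+w. ennreal (k (snd w) (fst w)) \<partial>lborel)))"
    by (simp add: nn_integral_cmult nn_integral_add Lp_mass_def)
  also have "\<dots> < top" using S I1 I2 by (simp add: ennreal_mult_less_top)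
  finally show ?thesis .
qed

section \<open>Approximation by mollification\<close>

text \<open>The tangent at \<open>a\<close> lies below the convex function \<open>t powr p\<close>; the point \<open>t = 0\<close> is included.\<close>

lemma powr_above_tangent:
  fixes a t p :: real
  assumes p: "1 \<le> p" and a: "0 < a" and t: "0 \<le> t"
  shows "a powr p + p * a powr (p - 1) * (t - a) \<le> t powr p"
proof (cases "t = 0")
  case True
  have "a powr (p - 1) * a = a powr p" using a powr_add[of a "p - 1" 1] by simp
  then have "a powr p + p * a powr (p - 1) * (t - a) = a powr p * (1 - p)"
    using True by (simp add: algebra_simps)
  also have "\<dots> \<le> 0" using p by (simp add: mult_nonneg_nonpos)
  finally show ?thesis using True by simp
next
  case False
  have "t powr p - a powr p \<ge> p * a powr (p - 1) * (t - a)"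
  proof (rule convex_on_imp_above_tangent[OF powr_convex[OF p]])
    show "((\<lambda>x. x powr p) has_real_derivative p * a powr (p - 1)) (at a within {0<..})"
      using a by (auto intro!: derivative_eq_intros)
  qed (use a t False in \<open>auto simp: interior_open\<close>)
  then show ?thesis by simp
qed

text \<open>Integrate the tangent inequality at the mean of \<open>|X|\<close> against the probability density \<open>\<rho>\<close>.
If the right-hand side is infinite, or if \<open>\<rho> X\<close> is not integrable and hence the integral on the
left is 0 by convention, then there is nothing to show.\<close>

lemma jensen_powr:
  fixes X \<rho> :: "'a::euclidean_space \<Rightarrow> real"
  assumes p: "1 \<le> p" and [measurable]: "X \<in> borel_measurable borel" "\<rho> \<in> borel_measurable borel"
    and \<rho>0: "\<And>z. 0 \<le> \<rho> z" and \<rho>1: "(\<integral>\<^sup>+z. ennreal (\<rho> z) \<partial>lborel) = 1"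
  shows "ennreal (\<bar>\<integral>z. \<rho> z * X z \<partial>lborel\<bar> powr p) \<le> (\<integral>\<^sup>+z. ennreal (\<rho> z * \<bar>X z\<bar> powr p) \<partial>lborel)"
proof (cases "integrable lborel (\<lambda>z. \<rho> z * X z) \<and> (\<integral>\<^sup>+z. ennreal (\<rho> z * \<bar>X z\<bar> powr p) \<partial>lborel) < top")
  case False
  then show ?thesis
    using p by (auto simp: not_integrable_integral_eq not_less top_unique)
next
  case True
  have i\<rho>: "integrable lborel \<rho>"
    using \<rho>0 \<rho>1 by (intro integrableI_nonneg) auto
  have I1: "(\<integral>z. \<rho> z \<partial>lborel) = 1"
    using \<rho>0 \<rho>1 by (subst integral_eq_nn_integral) auto
  have iX: "integrable lborel (\<lambda>z. \<rho> z * \<bar>X z\<bar>)"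
  proof -
    have "integrable lborel (\<lambda>z. norm (\<rho> z * X z))" using True by (intro integrable_norm) auto
    then show ?thesis using \<rho>0 by (simp add: abs_mult)
  qed
  have iP: "integrable lborel (\<lambda>z. \<rho> z * \<bar>X z\<bar> powr p)"
    using True \<rho>0 by (intro integrableI_nonneg) auto
  define a where "a = (\<integral>z. \<rho> z * \<bar>X z\<bar> \<partial>lborel)"
  have a0: "0 \<le> a" unfolding a_def using \<rho>0 by (intro integral_nonneg_AE) auto
  have "\<bar>\<integral>z. \<rho> z * X z \<partial>lborel\<bar> \<le> (\<integral>z. norm (\<rho> z * X z) \<partial>lborel)"
    using integral_norm_bound[of lborel "\<lambda>z. \<rho> z * X z"] by simp
  also have "\<dots> = a" using \<rho>0 by (simp add: a_def abs_mult)
  finally have "\<bar>\<integral>z. \<rho> z * X z \<partial>lborel\<bar> powr p \<le> a powr p" using p by (intro powr_mono2) auto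
  also have "a powr p \<le> (\<integral>z. \<rho> z * \<bar>X z\<bar> powr p \<partial>lborel)"
  proof (cases "a = 0")
    case True
    then show ?thesis using p \<rho>0 by (auto intro!: integral_nonneg_AE)
  next
    case False
    then have a: "0 < a" using a0 by simp
    let ?c = "p * a powr (p - 1)"
    have "a powr p = (a powr p - ?c * a) * (\<integral>z. \<rho> z \<partial>lborel) + ?c * (\<integral>z. \<rho> z * \<bar>X z\<bar> \<partial>lborel)"
      unfolding I1 a_def[symmetric] by simp
    also have "\<dots> = (\<integral>z. (a powr p - ?c * a) * \<rho> z + ?c * (\<rho> z * \<bar>X z\<bar>) \<partial>lborel)"
      using i\<rho> iX by simp
    also have "\<dots> \<le> (\<integral>z. \<rho> z * \<bar>X z\<bar> powr p \<partial>lborel)"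
    proof (rule integral_mono)
      fix z
      have "\<rho> z * (a powr p + ?c * (\<bar>X z\<bar> - a)) \<le> \<rho> z * \<bar>X z\<bar> powr p"
        using powr_above_tangent[OF p a, of "\<bar>X z\<bar>"] \<rho>0 by (intro mult_left_mono) auto
      then show "(a powr p - ?c * a) * \<rho> z + ?c * (\<rho> z * \<bar>X z\<bar>) \<le> \<rho> z * \<bar>X z\<bar> powr p"
        by (simp add: algebra_simps)
    qed (use i\<rho> iX iP in auto)
    finally show ?thesis .
  qed
  finally have "ennreal (\<bar>\<integral>z. \<rho> z * X z \<partial>lborel\<bar> powr p) \<le> ennreal (\<integral>z. \<rho> z * \<bar>X z\<bar> powr p \<partial>lborel)"
    by (rule ennreal_leI)
  also have "\<dots> = (\<integral>\<^sup>+z. ennreal (\<rho> z * \<bar>X z\<bar> powr p) \<partial>lborel)"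
    using iP \<rho>0 by (intro nn_integral_eq_integral[symmetric]) auto
  finally show ?thesis .
qed

text \<open>Jensen's inequality under the integral and Tonelli. The map \<open>v\<close> describes the direction of the
translations: the identity for functions on the space, the diagonal for difference quotients.\<close>

lemma Lp_mass_average_le:
  fixes h :: "'b::euclidean_space \<Rightarrow> real" and v :: "'a::euclidean_space \<Rightarrow> 'b"
  assumes p: "1 \<le> p" and [measurable]: "h \<in> borel_measurable borel" "\<rho> \<in> borel_measurable borel" "v \<in> borel_measurable borel"
    and \<rho>0: "\<And>z. 0 \<le> \<rho> z" and \<rho>1: "(\<integral>\<^sup>+z. ennreal (\<rho> z) \<partial>lborel) = 1"
    and \<eta>: "\<And>z. \<rho> z \<noteq> 0 \<Longrightarrow> Lp_mass p UNIV (\<lambda>w. h (w - v z) - h w) \<le> \<eta>"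
  shows "Lp_mass p UNIV (\<lambda>w. \<integral>z. \<rho> z * (h (w - v z) - h w) \<partial>lborel) \<le> \<eta>"
proof -
  have "Lp_mass p UNIV (\<lambda>w. \<integral>z. \<rho> z * (h (w - v z) - h w) \<partial>lborel)
    \<le> (\<integral>\<^sup>+w. \<integral>\<^sup>+z. ennreal (\<rho> z * \<bar>h (w - v z) - h w\<bar> powr p) \<partial>lborel \<partial>lborel)"
    unfolding Lp_mass_def using p \<rho>0 \<rho>1
    by (simp, intro nn_integral_mono jensen_powr) auto
  also have "\<dots> = (\<integral>\<^sup>+z. \<integral>\<^sup>+w. ennreal (\<rho> z * \<bar>h (w - v z) - h w\<bar> powr p) \<partial>lborel \<partial>lborel)"
    by (rule lborel_pair.Fubini') (simp add: split_beta')
  also have "\<dots> = (\<integral>\<^sup>+z. ennreal (\<rho> z) * Lp_mass p UNIV (\<lambda>w. h (w - v z) - h w) \<partial>lborel)"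
    unfolding Lp_mass_def using \<rho>0
    by (subst nn_integral_cmult[symmetric]) (auto simp: ennreal_mult)
  also have "\<dots> \<le> (\<integral>\<^sup>+z. ennreal (\<rho> z) * \<eta> \<partial>lborel)"
  proof (intro nn_integral_mono)
    show "ennreal (\<rho> z) * Lp_mass p UNIV (\<lambda>w. h (w - v z) - h w) \<le> ennreal (\<rho> z) * \<eta>" for z
      using \<eta>[of z] by (cases "\<rho> z = 0") (auto intro: mult_left_mono)
  qed
  also have "\<dots> = \<eta>" using \<rho>1 by (simp add: nn_integral_multc)
  finally show ?thesis .
qed

lemma shift_continuous_modulus:
  fixes h :: "'b::euclidean_space \<Rightarrow> real"
  assumes h: "shift_continuous p h" and \<eta>: "0 < (\<eta>::real)"
  obtains \<delta> where "\<delta> > 0" "\<And>u. norm u \<le> \<delta> \<Longrightarrow> Lp_mass p UNIV (\<lambda>w. h (w + u) - h w) \<le> ennreal \<eta>"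
proof (rule ccontr)
  assume "\<not> thesis"
  then have "\<exists>u. norm u \<le> 1 / real (Suc n) \<and> \<not> Lp_mass p UNIV (\<lambda>w. h (w + u) - h w) \<le> ennreal \<eta>" for n
    using that[of "1 / real (Suc n)"] by (auto simp del: of_nat_Suc)
  then obtain Z where Z: "\<And>n. norm (Z n) \<le> 1 / real (Suc n)" "\<And>n. \<not> Lp_mass p UNIV (\<lambda>w. h (w + Z n) - h w) \<le> ennreal \<eta>"
    by metis
  have "(\<lambda>n. 1 / real (Suc n)) \<longlonglongrightarrow> 0" by (rule lim_1_over_n[THEN LIMSEQ_Suc])
  then have "Z \<longlonglongrightarrow> 0"
    by (rule Lim_null_comparison[rotated]) (use Z(1) in auto)
  then have "(\<lambda>n. Lp_mass p UNIV (\<lambda>w. h (w + Z n) - h w)) \<longlonglongrightarrow> 0"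
    using h by (auto simp: shift_continuous_def)
  then have "\<forall>\<^sub>F n in sequentially. Lp_mass p UNIV (\<lambda>w. h (w + Z n) - h w) < ennreal \<eta>"
    using \<eta> by (auto simp: order_tendsto_iff)
  then obtain n where "Lp_mass p UNIV (\<lambda>w. h (w + Z n) - h w) < ennreal \<eta>"
    by (auto dest!: eventually_happens)
  then show False using Z(2)[of n] by simp
qed

lemma lborel_distr_reflect: "distr lborel borel (\<lambda>z. x - z) = (lborel :: 'a::euclidean_space measure)"
  using lborel_affine[of "-1" x] by (simp add: density_1)

lemma convolution_commute:
  fixes G \<rho> :: "'a::euclidean_space \<Rightarrow> real"
  assumes [measurable]: "G \<in> borel_measurable borel" "\<rho> \<in> borel_measurable borel"
  shows "convolution G \<rho> x = (\<integral>z. \<rho> z * G (x - z) \<partial>lborel)"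
proof -
  have "convolution G \<rho> x = (\<integral>y. G y * \<rho> (x - y) \<partial>(distr lborel borel (\<lambda>z. x - z)))"
    unfolding convolution_def lborel_distr_reflect ..
  also have "\<dots> = (\<integral>z. G (x - z) * \<rho> (x - (x - z)) \<partial>lborel)"
    by (rule integral_distr) auto
  finally show ?thesis by (simp add: mult.commute)
qed

lemma integrable_reflect:
  fixes f :: "'a::euclidean_space \<Rightarrow> real"
  assumes "integrable lborel f"
  shows "integrable lborel (\<lambda>z. f (x - z))"
  using assms integrable_distr[of "\<lambda>z. x - z" lborel borel f] by (simp add: lborel_distr_reflect)

text \<open>The mollified function minus \<open>G\<close> is an average of \<open>G(\<cdot> - z) - G\<close>. Its difference quotient is
the average of \<open>Q G(\<cdot> - (z, z)) - Q G\<close>, since a diagonal translation does not change the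
denominator. Both averages are small by continuity of translations.\<close>

theorem mollification_approximates:
  fixes G :: "'a::euclidean_space \<Rightarrow> real"
  assumes p: "1 \<le> p" and \<Omega>: "open \<Omega>"
    and [measurable]: "G \<in> borel_measurable borel"
    and K: "compact K" "K \<subseteq> \<Omega>" "\<And>x. G x \<noteq> 0 \<Longrightarrow> x \<in> K"
    and N: "Lp_mass p UNIV G < top" and S: "Lp_mass p UNIV (gagliardo_quotient s p G) < top"
    and \<eta>: "0 < (\<eta>::real)"
  shows "\<exists>g\<in>test_functions \<Omega>. Lp_mass p UNIV (\<lambda>x. G x - g x) \<le> ennreal \<eta> \<and>
    Lp_mass p UNIV (gagliardo_quotient s p (\<lambda>x. G x - g x)) \<le> ennreal \<eta>"
proof -
  let ?Q = "gagliardo_quotient s p"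
  have intG: "integrable lborel G"
  proof -
    have [measurable]: "K \<in> sets borel" using K by (simp add: borel_compact)
    have "emeasure lborel K < top" using emeasure_bounded_finite[OF compact_imp_bounded[OF K(1)]] by simp
    \<comment> \<open>\<open>|G|\<close> is at most 1 on \<open>K\<close> or at most its own \<open>p\<close>-th power\<close>
    have "integrable lborel (\<lambda>x. indicator K x + \<bar>G x\<bar> powr p)"
    proof (rule Bochner_Integration.integrable_add)
      show "integrable lborel (indicator K :: 'a \<Rightarrow> real)"
        using \<open>emeasure lborel K < top\<close> by simp
      show "integrable lborel (\<lambda>x. \<bar>G x\<bar> powr p)"
        using N by (intro integrableI_nonneg) (auto simp: Lp_mass_def)
    qed
    then show ?thesis
    proof (rule Bochner_Integration.integrable_bound)
      show "AE x in lborel. norm (G x) \<le> norm (indicator K x + \<bar>G x\<bar> powr p)"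
      proof (intro AE_I2)
        fix x
        have "\<bar>G x\<bar> \<le> indicator K x + \<bar>G x\<bar> powr p"
        proof (cases "\<bar>G x\<bar> \<le> 1")
          case True
          have "\<bar>G x\<bar> \<le> indicator K x"
            using True K(3)[of x] by (cases "G x = 0") (auto simp: indicator_def)
          moreover have "0 \<le> \<bar>G x\<bar> powr p" by simp
          ultimately show ?thesis by linarith
        next
          case False
          then have "\<bar>G x\<bar> powr 1 \<le> \<bar>G x\<bar> powr p" using p by (intro powr_mono) auto
          then show ?thesis using False by (auto simp: indicator_def)
        qed
        then show "norm (G x) \<le> norm (indicator K x + \<bar>G x\<bar> powr p)" by simp
      qed
    qed auto
  qed
  obtain r where r: "r > 0" "(\<Union>x\<in>K. cball x r) \<subseteq> \<Omega>"
    using compact_subset_open_imp_cball_epsilon_subset[OF K(1) \<Omega> K(2)] .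
  have "shift_continuous p G" and "shift_continuous p (?Q G)"
    using p N S by (auto intro!: shift_continuous_Lp)
  obtain \<delta>1 where \<delta>1: "\<delta>1 > 0"
    "\<And>u. norm u \<le> \<delta>1 \<Longrightarrow> Lp_mass p UNIV (\<lambda>w. G (w + u) - G w) \<le> ennreal \<eta>"
    using shift_continuous_modulus[OF \<open>shift_continuous p G\<close> \<eta>] by blast
  obtain \<delta>2 where \<delta>2: "\<delta>2 > 0"
    "\<And>u. norm u \<le> \<delta>2 \<Longrightarrow> Lp_mass p UNIV (\<lambda>w. ?Q G (w + u) - ?Q G w) \<le> ennreal \<eta>"
    using shift_continuous_modulus[OF \<open>shift_continuous p (?Q G)\<close> \<eta>] by blast
  \<comment> \<open>\<open>\<delta>2 / 2\<close>, because the diagonal translation by \<open>(z, z)\<close> has norm up to \<open>2 |z|\<close>\<close>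
  define e where "e = min r (min \<delta>1 (\<delta>2 / 2))"
  have e: "e > 0" using r \<delta>1(1) \<delta>2(1) by (simp add: e_def)
  obtain \<rho> :: "'a \<Rightarrow> real" where \<rho>: "smooth \<rho>" "\<And>x. 0 \<le> \<rho> x" "\<And>x. \<rho> x \<noteq> 0 \<Longrightarrow> norm x \<le> e"
    "(\<integral>\<^sup>+x. ennreal (\<rho> x) \<partial>lborel) = 1"
    using smooth_mollifier_exists[OF e] by blast
  have [measurable]: "\<rho> \<in> borel_measurable borel" using smooth_borel_measurable \<rho> by blast
  have int\<rho>: "integrable lborel \<rho>" and I1: "(\<integral>z. \<rho> z \<partial>lborel) = 1"
    using \<rho> by (auto intro!: integrableI_nonneg simp: integral_eq_nn_integral)
  define g where "g = convolution G \<rho>"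
  have sm: "smooth g" unfolding g_def by (rule smooth_convolution[OF intG \<rho>(1,3)])
  have g: "g x = (\<integral>z. \<rho> z * G (x - z) \<partial>lborel)" for x
    unfolding g_def by (rule convolution_commute) auto
  have int: "integrable lborel (\<lambda>z. \<rho> z * G (x - z))" for x
    using integrable_reflect[OF integrable_convolution[OF intG smooth_continuous_on[OF \<rho>(1)] \<rho>(3)], of x x]
    by (simp add: mult.commute)
  have diff: "g x - G x = (\<integral>z. \<rho> z * (G (x - z) - G x) \<partial>lborel)" for x
    unfolding g right_diff_distrib using int int\<rho> I1 by simp
  have diffQ: "?Q (\<lambda>x. g x - G x) w = (\<integral>z. \<rho> z * (?Q G (w - (z, z)) - ?Q G w) \<partial>lborel)" for w
  proof -
    define c where "c = norm (fst w - snd w) powr ((real DIM('a) + s * p) / p)"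
    have "?Q (\<lambda>x. g x - G x) w = ((\<integral>z. \<rho> z * (G (fst w - z) - G (fst w)) \<partial>lborel) - (\<integral>z. \<rho> z * (G (snd w - z) - G (snd w)) \<partial>lborel)) / c"
      unfolding gagliardo_quotient_def diff c_def ..
    also have "\<dots> = (\<integral>z. (\<rho> z * (G (fst w - z) - G (fst w)) - \<rho> z * (G (snd w - z) - G (snd w))) / c \<partial>lborel)"
      using int int\<rho> by (simp add: right_diff_distrib)
    also have "\<dots> = (\<integral>z. \<rho> z * (?Q G (w - (z, z)) - ?Q G w) \<partial>lborel)"
      by (intro Bochner_Integration.integral_cong)
         (auto simp: gagliardo_quotient_def c_def diff_divide_distrib right_diff_distrib)
    finally show ?thesis .
  qed
  have 1: "Lp_mass p UNIV (\<lambda>x. g x - G x) \<le> ennreal \<eta>"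
    unfolding diff
  proof (rule Lp_mass_average_le[OF p, of G \<rho> "\<lambda>z. z"])
    show "Lp_mass p UNIV (\<lambda>w. G (w - z) - G w) \<le> ennreal \<eta>" if "\<rho> z \<noteq> 0" for z
      using \<delta>1(2)[of "- z"] \<rho>(3)[OF that] by (simp add: e_def)
  qed (use \<rho> in auto)
  have "Lp_mass p UNIV (\<lambda>w. \<integral>z. \<rho> z * (?Q G (w - (z, z)) - ?Q G w) \<partial>lborel) \<le> ennreal \<eta>"
  proof (rule Lp_mass_average_le[OF p, of "?Q G" \<rho> "\<lambda>z. (z, z)"])
    show "Lp_mass p UNIV (\<lambda>w. ?Q G (w - (z, z)) - ?Q G w) \<le> ennreal \<eta>" if "\<rho> z \<noteq> 0" for z
    proof -
      have "norm (z, z) \<le> norm z + norm z" by (rule norm_Pair_le)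
      also have "\<dots> \<le> \<delta>2" using \<rho>(3)[OF that] by (simp add: e_def)
      finally show ?thesis using \<delta>2(2)[of "- (z, z)"]
        by (simp only: norm_minus_cancel add_uminus_conv_diff)
    qed
    show "(\<lambda>z::'a. (z, z)) \<in> borel_measurable borel"
      by (intro borel_measurable_continuous_onI continuous_intros)
  qed (use \<rho> in auto)
  then have 2: "Lp_mass p UNIV (?Q (\<lambda>x. g x - G x)) \<le> ennreal \<eta>"
    by (subst ext[of "?Q (\<lambda>x. g x - G x)", OF diffQ])
  have "g \<in> test_functions \<Omega>"
  proof -
    define K' where "K' = {x + y | x y. x \<in> K \<and> y \<in> cball 0 e}"
    have K'c: "compact K'" unfolding K'_def by (rule compact_sums[OF K(1) compact_cball])
    have "K' \<subseteq> \<Omega>"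
    proof
      fix u assume "u \<in> K'"
      then obtain x y where "u = x + y" "x \<in> K" "norm y \<le> e" unfolding K'_def by auto
      then have "u \<in> cball x r" by (simp add: dist_norm e_def)
      then show "u \<in> \<Omega>" using r \<open>x \<in> K\<close> by blast
    qed
    have "{x. g x \<noteq> 0} \<subseteq> K'"
    proof
      fix x assume "x \<in> {x. g x \<noteq> 0}"
      then have "g x \<noteq> 0" by simp
      have "\<not> (\<forall>z. \<rho> z * G (x - z) = 0)"
      proof
        assume "\<forall>z. \<rho> z * G (x - z) = 0"
        then have "g x = (\<integral>z. 0 \<partial>(lborel :: 'a measure))"
          unfolding g by (intro Bochner_Integration.integral_cong) blast+
        with \<open>g x \<noteq> 0\<close> show False by simp
      qed
      then obtain z where "\<rho> z \<noteq> 0" "G (x - z) \<noteq> 0" by auto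
      then have "x - z \<in> K" "z \<in> cball 0 e" using K(3) \<rho>(3) by auto
      moreover have "x = (x - z) + z" by simp
      ultimately show "x \<in> K'" unfolding K'_def by blast
    qed
    then have cl: "closure {x. g x \<noteq> 0} \<subseteq> K'" using K'c by (intro closure_minimal compact_imp_closed)
    then have "compact (closure {x. g x \<noteq> 0})"
      using compact_Int_closed[OF K'c closed_closure] by (metis inf.absorb_iff2)
    then show ?thesis using sm cl \<open>K' \<subseteq> \<Omega>\<close> by (auto simp: test_functions_def)
  qed
  moreover have "Lp_mass p UNIV (?Q (\<lambda>x. G x - g x)) = Lp_mass p UNIV (?Q (\<lambda>x. g x - G x))"
    unfolding gagliardo_quotient_diff by (rule Lp_mass_commute)
  ultimately show ?thesis
    using 1 2 Lp_mass_commute[of p UNIV G g] by (intro bexI[of _ g] conjI) simp_all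
qed

section \<open>Roots and powers of extended reals\<close>

lemma epowr_less_iff:
  assumes "0 < a" "0 < e"
  shows "x epowr a < ennreal e \<longleftrightarrow> x < ennreal (e powr (1 / a))"
proof (cases x)
  case (real r)
  have "r powr a < e \<longleftrightarrow> r < e powr (1 / a)"
  proof
    assume "r powr a < e"
    then have "(r powr a) powr (1 / a) < e powr (1 / a)" using assms by (intro powr_less_mono2) auto
    then show "r < e powr (1 / a)" using assms real by (cases "r = 0") (auto simp: powr_powr)
  next
    assume "r < e powr (1 / a)"
    then have "r powr a < (e powr (1 / a)) powr a" using assms real by (intro powr_less_mono2) auto
    then show "r powr a < e" using assms by (simp add: powr_powr)
  qed
  then show ?thesis using real assms by (simp add: ennreal_powr_def ennreal_less_iff)
qed (simp add: ennreal_powr_def)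

lemma epowr_less_top_iff: "x epowr a < top \<longleftrightarrow> x < top"
  by (simp add: ennreal_powr_def less_top)

text \<open>This bounds the \<open>p\<close>-th power of the Sobolev norm by the two \<open>p\<close>-th power integrals.\<close>

lemma epowr_add_le:
  assumes p: "1 \<le> p"
  shows "(x epowr (1 / p) + y epowr (1 / p)) epowr p \<le> ennreal (2 powr p) * (x + y)"
proof (cases "x = top \<or> y = top")
  case False
  then obtain a b where ab: "x = ennreal a" "y = ennreal b" "0 \<le> a" "0 \<le> b"
    by (metis ennreal_cases)
  have "(a powr (1 / p) + b powr (1 / p)) powr p \<le> 2 powr p * (a + b)"
    using abs_add_powr_le[of p "a powr (1 / p)" "b powr (1 / p)"] p ab by (simp add: powr_powr)
  moreover have "(x epowr (1 / p) + y epowr (1 / p)) epowr p = ennreal ((a powr (1 / p) + b powr (1 / p)) powr p)"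
    using ab by (simp add: ennreal_powr_def flip: ennreal_plus)
  moreover have "ennreal (2 powr p) * (x + y) = ennreal (2 powr p * (a + b))"
    using ab by (simp add: ennreal_mult)
  ultimately show ?thesis by (simp add: ennreal_leI)
qed (auto simp: ennreal_mult_eq_top_iff)

section \<open>Borel representatives\<close>

lemma nn_integral_lebesgue_on:
  assumes "open \<Omega>"
  shows "(\<integral>\<^sup>+x. u x \<partial>lebesgue_on \<Omega>) = (\<integral>\<^sup>+x. u x * indicator \<Omega> x \<partial>(lborel :: 'a::euclidean_space measure))"
  using assms by (subst nn_integral_restrict_space) (auto simp: nn_integral_completion)

text \<open>Lebesgue measurable functions are replaced by Borel functions on the whole space, so that the
double integrals become integrals of jointly measurable functions over the product space.\<close>

lemma Borel_representative:
  fixes f :: "'a::euclidean_space \<Rightarrow> real"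
  assumes \<Omega>: "open \<Omega>" and f: "f \<in> borel_measurable (lebesgue_on \<Omega>)"
  obtains F where "F \<in> borel_measurable borel" "\<And>x. x \<notin> \<Omega> \<Longrightarrow> F x = 0"
    "AE x in lborel. x \<in> \<Omega> \<longrightarrow> f x = F x"
proof -
  have "(\<lambda>x. indicator \<Omega> x *\<^sub>R f x) \<in> borel_measurable lebesgue"
    using f \<Omega> by (subst borel_measurable_restrict_space_iff[symmetric]) auto
  from completion_ex_borel_measurable_real[OF this]
  obtain g where g: "g \<in> borel_measurable lborel" "AE x in lborel. indicator \<Omega> x *\<^sub>R f x = g x" by blast
  have [measurable]: "\<Omega> \<in> sets borel" using \<Omega> by auto
  show ?thesis
  proof (rule that[of "\<lambda>x. indicator \<Omega> x * g x"])
    show "AE x in lborel. x \<in> \<Omega> \<longrightarrow> f x = indicator \<Omega> x * g x"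
      using g(2) by eventually_elim auto
  qed (use g(1) in auto)
qed

lemma Lp_integral_eq_Lp_mass:
  fixes f F :: "'a::euclidean_space \<Rightarrow> real"
  assumes \<Omega>: "open \<Omega>" and ae: "AE x in lborel. x \<in> \<Omega> \<longrightarrow> f x = F x"
  shows "(\<integral>\<^sup>+x. ennreal (\<bar>f x\<bar> powr p) \<partial>lebesgue_on \<Omega>) = Lp_mass p \<Omega> F"
  unfolding nn_integral_lebesgue_on[OF \<Omega>] Lp_mass_def
  by (rule nn_integral_cong_AE, use ae in eventually_elim) (auto simp: indicator_def)

lemma gagliardo_integral_eq_Lp_mass:
  fixes f F :: "'a::euclidean_space \<Rightarrow> real"
  assumes p: "0 < p" and \<Omega>: "open \<Omega>" and ae: "AE x in lborel. x \<in> \<Omega> \<longrightarrow> f x = F x"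
    and [measurable]: "F \<in> borel_measurable borel"
  shows "(\<integral>\<^sup>+x. \<integral>\<^sup>+y. ennreal (\<bar>f x - f y\<bar> powr p / norm (x - y) powr (real DIM('a) + s * p))
        \<partial>lebesgue_on \<Omega> \<partial>lebesgue_on \<Omega>) = Lp_mass p (\<Omega> \<times> \<Omega>) (gagliardo_quotient s p F)"
proof -
  have [measurable]: "\<Omega> \<in> sets borel" using \<Omega> by auto
  have [measurable]: "\<Omega> \<times> \<Omega> \<in> sets borel" by (intro borel_Times) auto
  let ?k = "\<lambda>f x y. ennreal (\<bar>f x - f y\<bar> powr p / norm (x - y) powr (real DIM('a) + s * p))"
  let ?g = "\<lambda>w. ennreal (\<bar>gagliardo_quotient s p F w\<bar> powr p) * indicator (\<Omega> \<times> \<Omega>) w"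
  have "(\<integral>\<^sup>+x. \<integral>\<^sup>+y. ?k f x y \<partial>lebesgue_on \<Omega> \<partial>lebesgue_on \<Omega>)
    = (\<integral>\<^sup>+x. (\<integral>\<^sup>+y. ?k f x y * indicator \<Omega> y \<partial>lborel) * indicator \<Omega> x \<partial>lborel)"
    unfolding nn_integral_lebesgue_on[OF \<Omega>] ..
  also have "\<dots> = (\<integral>\<^sup>+x. \<integral>\<^sup>+y. ?g (x, y) \<partial>lborel \<partial>lborel)"
  proof (rule nn_integral_cong_AE, use ae in eventually_elim)
    fix x assume x: "x \<in> \<Omega> \<longrightarrow> f x = F x"
    show "(\<integral>\<^sup>+y. ?k f x y * indicator \<Omega> y \<partial>lborel) * indicator \<Omega> x = (\<integral>\<^sup>+y. ?g (x, y) \<partial>lborel)"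
    proof (cases "x \<in> \<Omega>")
      case True
      have "(\<integral>\<^sup>+y. ?k f x y * indicator \<Omega> y \<partial>lborel) = (\<integral>\<^sup>+y. ?g (x, y) \<partial>lborel)"
        by (rule nn_integral_cong_AE, use ae in eventually_elim)
           (use True x p in \<open>auto simp: indicator_def gagliardo_quotient_powr\<close>)
      then show ?thesis using True by simp
    qed (simp add: indicator_def)
  qed
  also have "\<dots> = (\<integral>\<^sup>+w. ?g w \<partial>(lborel \<Otimes>\<^sub>M lborel))"
    by (rule lborel.nn_integral_fst) (simp add: borel_prod lborel_prod)
  finally show ?thesis by (simp add: Lp_mass_def lborel_prod)
qed

section \<open>The Hardy weight\<close>

text \<open>The weight in the Hardy integral as a real number. If there is no boundary, then the distance is
infinite and the weight is 0.\<close>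

definition hardy_weight :: "real \<Rightarrow> 'a::euclidean_space set \<Rightarrow> 'a \<Rightarrow> real" where
  "hardy_weight a \<Omega> x = (if frontier \<Omega> = {} then 0 else infdist x (frontier \<Omega>) powr (- a))"

lemma hardy_weight_nonneg: "0 \<le> hardy_weight a \<Omega> x"
  by (simp add: hardy_weight_def)

lemma hardy_weight_measurable [measurable]: "hardy_weight a \<Omega> \<in> borel_measurable borel"
proof -
  have [measurable]: "(\<lambda>x. infdist x (frontier \<Omega>)) \<in> borel_measurable borel"
    by (intro borel_measurable_continuous_onI continuous_intros)
  show ?thesis unfolding hardy_weight_def by measurable
qed

lemma bdist_eq_infdist:
  assumes "frontier \<Omega> \<noteq> {}"
  shows "bdist \<Omega> x = ennreal (infdist x (frontier \<Omega>))"
proof (rule antisym)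
  obtain y where y: "y \<in> frontier \<Omega>" "infdist x (frontier \<Omega>) = dist x y"
    using infdist_attains_inf[OF frontier_closed assms] by blast
  show "bdist \<Omega> x \<le> ennreal (infdist x (frontier \<Omega>))"
    unfolding bdist_def y(2) dist_norm by (rule INF_lower[OF y(1)])
  show "ennreal (infdist x (frontier \<Omega>)) \<le> bdist \<Omega> x"
    unfolding bdist_def
    by (intro INF_greatest ennreal_leI) (metis dist_norm infdist_le)
qed

lemma infdist_frontier_pos:
  assumes "open \<Omega>" "x \<in> \<Omega>" "frontier \<Omega> \<noteq> {}"
  shows "0 < infdist x (frontier \<Omega>)"
proof -
  have "x \<notin> frontier \<Omega>" using assms by (auto simp: frontier_def interior_open)
  then have "infdist x (frontier \<Omega>) \<noteq> 0"
    using in_closed_iff_infdist_zero[OF frontier_closed assms(3)] by auto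
  then show ?thesis using infdist_nonneg[of x "frontier \<Omega>"] by simp
qed

lemma divide_bdist_powr:
  assumes "open \<Omega>" "x \<in> \<Omega>" "0 \<le> b"
  shows "ennreal b / (bdist \<Omega> x epowr a) = ennreal (b * hardy_weight a \<Omega> x)"
proof (cases "frontier \<Omega> = {}")
  case True
  then show ?thesis by (simp add: bdist_def ennreal_powr_def hardy_weight_def)
next
  case False
  have "0 < infdist x (frontier \<Omega>)" using infdist_frontier_pos assms False by blast
  then show ?thesis
    using False assms by (simp add: bdist_eq_infdist ennreal_powr_def hardy_weight_def divide_ennreal powr_minus_divide)
qed

text \<open>The segment from \<open>x\<close> to the nearest point of the complement meets the boundary.\<close>

lemma infdist_frontier_le_complement:
  fixes \<Omega> :: "'a::euclidean_space set"
  assumes "x \<in> \<Omega>" "closed (- \<Omega>)" "\<Omega> \<noteq> UNIV"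
  shows "infdist x (frontier \<Omega>) \<le> infdist x (- \<Omega>)"
proof -
  have "- \<Omega> \<noteq> {}" using assms by auto
  then obtain y where y: "y \<in> - \<Omega>" "infdist x (- \<Omega>) = dist x y"
    using infdist_attains_inf[OF assms(2) \<open>- \<Omega> \<noteq> {}\<close>] by blast
  have "closed_segment x y \<inter> frontier \<Omega> \<noteq> {}"
    using assms y by (intro connected_Int_frontier) auto
  then obtain z where z: "z \<in> closed_segment x y" "z \<in> frontier \<Omega>" by blast
  have "infdist x (frontier \<Omega>) \<le> dist x z" using z(2) by (rule infdist_le)
  also have "\<dots> \<le> dist x y" using dist_in_closed_segment[OF z(1)] by (simp add: dist_commute)
  finally show ?thesis using y by simp
qed

lemma complement_dist_powr_le:
  assumes \<Omega>: "open \<Omega>" "x \<in> \<Omega>" and a: "0 < a"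
  shows "complement_dist \<Omega> x powr (- a) \<le> 1 + hardy_weight a \<Omega> x"
proof (cases "\<Omega> = UNIV")
  case True
  then show ?thesis by (simp add: complement_dist_def hardy_weight_nonneg)
next
  case False
  then have fr: "frontier \<Omega> \<noteq> {}" using \<Omega> by (auto simp: frontier_eq_empty)
  let ?d = "infdist x (frontier \<Omega>)"
  have d: "0 < ?d" using infdist_frontier_pos \<Omega> fr by blast
  have "min 1 ?d \<le> complement_dist \<Omega> x"
    using infdist_frontier_le_complement[of x \<Omega>] \<Omega> False by (auto simp: complement_dist_def closed_def)
  then have "complement_dist \<Omega> x powr (- a) \<le> min 1 ?d powr (- a)"
    using d a by (intro powr_mono2') auto
  also have "\<dots> \<le> 1 + ?d powr (- a)" by (auto simp: min_def)
  finally show ?thesis using fr by (simp add: hardy_weight_def)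
qed

lemma hardy_integral_eq:
  fixes f F :: "'a::euclidean_space \<Rightarrow> real"
  assumes \<Omega>: "open \<Omega>" and ae: "AE x in lborel. x \<in> \<Omega> \<longrightarrow> f x = F x"
  shows "hardy_integral s p \<Omega> f = (\<integral>\<^sup>+x. ennreal (\<bar>F x\<bar> powr p * hardy_weight (s * p) \<Omega> x) * indicator \<Omega> x \<partial>lborel)"
  unfolding hardy_integral_def nn_integral_lebesgue_on[OF \<Omega>]
  by (rule nn_integral_cong_AE, use ae in eventually_elim) (auto simp: indicator_def divide_bdist_powr[OF \<Omega>])

section \<open>The closure of the test functions\<close>

lemma frac_sobolev_norm_less:
  assumes p: "1 \<le> p" and e: "0 < e"
    and "(\<integral>\<^sup>+x. ennreal (\<bar>f x\<bar> powr p) \<partial>lebesgue_on \<Omega>) < ennreal ((e / 2) powr p)"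
    and "(\<integral>\<^sup>+x. \<integral>\<^sup>+y. ennreal (\<bar>f x - f y\<bar> powr p / norm (x - y) powr (real DIM('a::euclidean_space) + s * p))
        \<partial>lebesgue_on \<Omega> \<partial>lebesgue_on \<Omega>) < ennreal ((e / 2) powr p)"
  shows "frac_sobolev_norm s p (\<Omega> :: 'a set) f < ennreal e"
proof -
  have "Lp_norm p \<Omega> f < ennreal (e / 2)" "gagliardo_seminorm s p \<Omega> f < ennreal (e / 2)"
    unfolding Lp_norm_def gagliardo_seminorm_def using assms by (simp_all add: epowr_less_iff)
  then have "frac_sobolev_norm s p \<Omega> f < ennreal (e / 2) + ennreal (e / 2)"
    unfolding frac_sobolev_norm_def by (rule add_strict_mono)
  also have "\<dots> = ennreal e" using e by (simp flip: ennreal_plus)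
  finally show ?thesis .
qed

lemma frac_sobolev_norm_lessD:
  assumes p: "1 \<le> p" and e: "0 < e" and less: "frac_sobolev_norm s p (\<Omega> :: 'a::euclidean_space set) f < ennreal e"
  shows "(\<integral>\<^sup>+x. ennreal (\<bar>f x\<bar> powr p) \<partial>lebesgue_on \<Omega>) < ennreal (e powr p)"
    and "(\<integral>\<^sup>+x. \<integral>\<^sup>+y. ennreal (\<bar>f x - f y\<bar> powr p / norm (x - y) powr (real DIM('a) + s * p))
        \<partial>lebesgue_on \<Omega> \<partial>lebesgue_on \<Omega>) < ennreal (e powr p)"
proof -
  have "Lp_norm p \<Omega> f \<le> frac_sobolev_norm s p \<Omega> f" "gagliardo_seminorm s p \<Omega> f \<le> frac_sobolev_norm s p \<Omega> f"
    by (auto simp: frac_sobolev_norm_def)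
  then have "Lp_norm p \<Omega> f < ennreal e" "gagliardo_seminorm s p \<Omega> f < ennreal e"
    using less by auto
  then show "(\<integral>\<^sup>+x. ennreal (\<bar>f x\<bar> powr p) \<partial>lebesgue_on \<Omega>) < ennreal (e powr p)"
    "(\<integral>\<^sup>+x. \<integral>\<^sup>+y. ennreal (\<bar>f x - f y\<bar> powr p / norm (x - y) powr (real DIM('a) + s * p))
        \<partial>lebesgue_on \<Omega> \<partial>lebesgue_on \<Omega>) < ennreal (e powr p)"
    unfolding Lp_norm_def gagliardo_seminorm_def using p e by (simp_all add: epowr_less_iff)
qed

lemma Lp_mass_quotient_diff_le:
  assumes "0 \<le> p" and [measurable]: "F \<in> borel_measurable borel" "G \<in> borel_measurable borel" "A \<in> sets borel"
  shows "Lp_mass p A (gagliardo_quotient s p (\<lambda>x. F x - G x)) \<le>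
    ennreal (2 powr p) * (Lp_mass p A (gagliardo_quotient s p F) + Lp_mass p A (gagliardo_quotient s p G))"
  unfolding gagliardo_quotient_diff using assms by (intro Lp_mass_diff_le) auto

text \<open>The approximating test function depends on the level \<open>n\<close> at which the weight is truncated;
the resulting bound does not.\<close>

lemma hardy_integral_finite_of_closure:
  fixes f :: "'a::euclidean_space \<Rightarrow> real"
  assumes p: "1 \<le> p" and \<Omega>: "open \<Omega>" and hardy: "weak_frac_hardy s p \<Omega>"
    and f0: "f \<in> frac_sobolev_zero s p \<Omega>"
  shows "hardy_integral s p \<Omega> f < top"
proof -
  let ?Q = "gagliardo_quotient s p" and ?w = "hardy_weight (s * p) \<Omega>" and ?C = "ennreal (2 powr p)"
  let ?N = "Lp_mass p \<Omega>" and ?S = "\<lambda>F. Lp_mass p (\<Omega> \<times> \<Omega>) (?Q F)"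
  have \<Omega>m[measurable]: "\<Omega> \<in> sets borel" using \<Omega> by auto
  have \<Omega>m2[measurable]: "\<Omega> \<times> \<Omega> \<in> sets borel" by (intro borel_Times) auto
  have f: "f \<in> frac_sobolev s p \<Omega>"
    and approx: "\<And>e. 0 < e \<Longrightarrow> \<exists>g\<in>test_functions \<Omega>. frac_sobolev_norm s p \<Omega> (\<lambda>x. f x - g x) < ennreal e"
    using f0 by (auto simp: frac_sobolev_zero_def)
  then have fm: "f \<in> borel_measurable (lebesgue_on \<Omega>)" by (simp add: frac_sobolev_def)
  obtain F where [measurable]: "F \<in> borel_measurable borel"
    and ae: "AE x in lborel. x \<in> \<Omega> \<longrightarrow> f x = F x"
    using Borel_representative[OF \<Omega> fm] by metis
  have p0: "0 < p" using p by simp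
  note LN = Lp_integral_eq_Lp_mass[OF \<Omega>] and LS = gagliardo_integral_eq_Lp_mass[OF p0 \<Omega>]
  have finF: "?N F < top" "?S F < top"
    using f LN[OF ae, of p] LS[OF ae]
    by (auto simp: frac_sobolev_def Lp_norm_def gagliardo_seminorm_def epowr_less_top_iff)
  obtain c where c: "\<And>g. g \<in> test_functions \<Omega> \<Longrightarrow> hardy_integral s p \<Omega> g \<le> ennreal c * (frac_sobolev_norm s p \<Omega> g) epowr p"
    using hardy by (auto simp: weak_frac_hardy_def)
  \<comment> \<open>the bound: 1 for the error term, the remainder for the Hardy inequality of an approximant
  whose \<open>p\<close>-th power integrals exceed those of \<open>f\<close> by at most 1 up to constants\<close>
  define B where "B = ?C * (1 + ennreal c * (?C * (?C * (?N F + 1) + ?C * (?S F + 1))))"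
  have "B < top" unfolding B_def using finF by (simp add: ennreal_mult_less_top)
  define E where "E n = {x. ?w x \<le> real n}" for n
  have [measurable]: "E n \<in> sets borel" for n unfolding E_def by measurable
  define u where "u n x = ennreal (\<bar>F x\<bar> powr p * ?w x) * indicator \<Omega> x * indicator (E n) x" for n x
  have [measurable]: "u n \<in> borel_measurable borel" for n unfolding u_def by measurable
  have le: "(\<integral>\<^sup>+x. u n x \<partial>lborel) \<le> B" for n
  proof -
    \<comment> \<open>an error whose product with the truncation level \<open>n\<close> is at most 1\<close>
    define \<eta> where "\<eta> = 1 / real (Suc n)"
    have \<eta>: "0 < \<eta>" "\<eta> \<le> 1" "real n * \<eta> \<le> 1" by (auto simp: \<eta>_def)
    have "0 < \<eta> powr (1 / p)" using \<eta> by simp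
    from approx[OF this] obtain g where g: "g \<in> test_functions \<Omega>"
      and gn: "frac_sobolev_norm s p \<Omega> (\<lambda>x. f x - g x) < ennreal (\<eta> powr (1 / p))" by blast
    have [measurable]: "g \<in> borel_measurable borel"
      using g smooth_borel_measurable[of g] by (simp add: test_functions_def)
    have aed: "AE x in lborel. x \<in> \<Omega> \<longrightarrow> f x - g x = F x - g x"
      using ae by eventually_elim auto
    have aeg: "AE x in lborel. x \<in> \<Omega> \<longrightarrow> g x = g x" by simp
    have ee: "(\<eta> powr (1 / p)) powr p = \<eta>" using p \<eta> by (simp add: powr_powr)
    note D = frac_sobolev_norm_lessD[OF p \<open>0 < \<eta> powr (1 / p)\<close> gn, unfolded ee]
    have d: "?N (\<lambda>x. F x - g x) < ennreal \<eta>" "?S (\<lambda>x. F x - g x) < ennreal \<eta>"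
      using D LN[OF aed, of p] LS[OF aed] by auto
    have "ennreal \<eta> \<le> 1" using \<eta>(2) by (simp add: ennreal_le_1)
    then have d1: "?N (\<lambda>x. F x - g x) \<le> 1" "?S (\<lambda>x. F x - g x) \<le> 1"
      using order_trans[OF less_imp_le[OF d(1)]] order_trans[OF less_imp_le[OF d(2)]] by blast+
    have "?N g \<le> ?C * (?N F + ?N (\<lambda>x. F x - g x))"
      using Lp_mass_diff_le[of p F "\<lambda>x. F x - g x" \<Omega>] p by simp
    also have "\<dots> \<le> ?C * (?N F + 1)"
      using d1(1) by (intro mult_left_mono add_left_mono) auto
    finally have Ng: "?N g \<le> ?C * (?N F + 1)" .
    have "?S g \<le> ?C * (?S F + ?S (\<lambda>x. F x - g x))"
      using Lp_mass_quotient_diff_le[of p F "\<lambda>x. F x - g x" "\<Omega> \<times> \<Omega>" s] p by simp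
    also have "\<dots> \<le> ?C * (?S F + 1)"
      using d1(2) by (intro mult_left_mono add_left_mono) auto
    finally have Sg: "?S g \<le> ?C * (?S F + 1)" .
    have "(frac_sobolev_norm s p \<Omega> g) epowr p \<le> ?C * (?N g + ?S g)"
      unfolding frac_sobolev_norm_def Lp_norm_def gagliardo_seminorm_def LN[OF aeg] LS[OF aeg \<open>g \<in> borel_measurable borel\<close>]
      by (rule epowr_add_le[OF p])
    also have "\<dots> \<le> ?C * (?C * (?N F + 1) + ?C * (?S F + 1))"
      using Ng Sg by (intro mult_left_mono add_mono) auto
    finally have hg: "hardy_integral s p \<Omega> g \<le> ennreal c * (?C * (?C * (?N F + 1) + ?C * (?S F + 1)))"
      by (intro order_trans[OF c[OF g]] mult_left_mono) auto
    have "(\<integral>\<^sup>+x. u n x \<partial>lborel) \<le> (\<integral>\<^sup>+x. ?C * (ennreal (real n) * (ennreal (\<bar>F x - g x\<bar> powr p) * indicator \<Omega> x)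
      + ennreal (\<bar>g x\<bar> powr p * ?w x) * indicator \<Omega> x) \<partial>lborel)"
    proof (intro nn_integral_mono)
      fix x
      show "u n x \<le> ?C * (ennreal (real n) * (ennreal (\<bar>F x - g x\<bar> powr p) * indicator \<Omega> x)
        + ennreal (\<bar>g x\<bar> powr p * ?w x) * indicator \<Omega> x)"
      proof (cases "x \<in> \<Omega> \<and> x \<in> E n")
        case True
        have w: "0 \<le> ?w x" "?w x \<le> real n" using True by (auto simp: hardy_weight_nonneg E_def)
        have "\<bar>F x\<bar> powr p * ?w x \<le> (2 powr p * (\<bar>F x - g x\<bar> powr p + \<bar>g x\<bar> powr p)) * ?w x"
          using abs_add_powr_le[of p "F x - g x" "g x"] p w by (intro mult_right_mono) auto
        also have "\<dots> = 2 powr p * (?w x * \<bar>F x - g x\<bar> powr p + \<bar>g x\<bar> powr p * ?w x)"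
          by (simp add: algebra_simps)
        also have "\<dots> \<le> 2 powr p * (real n * \<bar>F x - g x\<bar> powr p + \<bar>g x\<bar> powr p * ?w x)"
          using w by (intro mult_left_mono add_right_mono mult_right_mono) auto
        finally have "ennreal (\<bar>F x\<bar> powr p * ?w x) \<le> ennreal (2 powr p * (real n * \<bar>F x - g x\<bar> powr p + \<bar>g x\<bar> powr p * ?w x))"
          by (rule ennreal_leI)
        then show ?thesis using True w by (simp add: u_def ennreal_mult)
      qed (auto simp: u_def)
    qed
    also have "\<dots> = ?C * (ennreal (real n) * ?N (\<lambda>x. F x - g x) + hardy_integral s p \<Omega> g)"
      unfolding hardy_integral_eq[OF \<Omega> aeg] Lp_mass_def
      by (simp add: nn_integral_cmult nn_integral_add)
    also have "\<dots> \<le> B"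
      unfolding B_def
    proof (intro mult_left_mono add_mono hg)
      have "ennreal (real n) * ?N (\<lambda>x. F x - g x) \<le> ennreal (real n) * ennreal \<eta>"
        using d by (intro mult_left_mono) auto
      also have "\<dots> = ennreal (real n * \<eta>)" using \<eta> by (simp add: ennreal_mult)
      also have "\<dots> \<le> 1" using \<eta> by (simp add: ennreal_le_1)
      finally show "ennreal (real n) * ?N (\<lambda>x. F x - g x) \<le> 1" .
    qed auto
    finally show ?thesis .
  qed
  have "(\<lambda>n. \<integral>\<^sup>+x. u n x \<partial>lborel) \<longlonglongrightarrow> (\<integral>\<^sup>+x. ennreal (\<bar>F x\<bar> powr p * ?w x) * indicator \<Omega> x \<partial>lborel)"
  proof (rule nn_integral_LIMSEQ)
    show "incseq u"
      by (auto simp: incseq_def le_fun_def u_def E_def indicator_def)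
    fix x
    obtain m :: nat where "?w x \<le> real m" using real_arch_simple by blast
    then have "\<forall>\<^sub>F n in sequentially. u n x = ennreal (\<bar>F x\<bar> powr p * ?w x) * indicator \<Omega> x"
      by (intro eventually_sequentiallyI[of m]) (auto simp: u_def E_def)
    then show "(\<lambda>n. u n x) \<longlonglongrightarrow> ennreal (\<bar>F x\<bar> powr p * ?w x) * indicator \<Omega> x"
      by (rule tendsto_eventually)
  qed auto
  then have "(\<integral>\<^sup>+x. ennreal (\<bar>F x\<bar> powr p * ?w x) * indicator \<Omega> x \<partial>lborel) \<le> B"
    by (rule LIMSEQ_le_const2) (use le in auto)
  then show ?thesis using \<open>B < top\<close> hardy_integral_eq[OF \<Omega> ae, of s p] by simp
qed

text \<open>Cut off, then mollify. The finite Hardy integral makes the weight \<open>D powr (- s p)\<close> integrable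
against \<open>|F| powr p\<close>, because that weight is at most 1 plus the Hardy weight.\<close>

lemma test_functions_dense:
  fixes f :: "'a::euclidean_space \<Rightarrow> real"
  assumes s: "0 < s" "s < 1" and p: "1 \<le> p" and \<Omega>: "open \<Omega>"
    and f: "f \<in> frac_sobolev s p \<Omega>" and hardy: "hardy_integral s p \<Omega> f < top"
  shows "f \<in> frac_sobolev_zero s p \<Omega>"
proof -
  let ?Q = "gagliardo_quotient s p" and ?C = "ennreal (2 powr p)"
  let ?N = "Lp_mass p \<Omega>" and ?S = "\<lambda>F. Lp_mass p (\<Omega> \<times> \<Omega>) (?Q F)"
  let ?D = "complement_dist \<Omega>" and ?\<theta> = "cutoff \<Omega>"
  have \<Omega>m[measurable]: "\<Omega> \<in> sets borel" using \<Omega> by auto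
  have \<Omega>m2[measurable]: "\<Omega> \<times> \<Omega> \<in> sets borel" by (intro borel_Times) auto
  have p0: "0 < p" using p by simp
  note LN = Lp_integral_eq_Lp_mass[OF \<Omega>] and LS = gagliardo_integral_eq_Lp_mass[OF p0 \<Omega>]
  have fm: "f \<in> borel_measurable (lebesgue_on \<Omega>)" using f by (simp add: frac_sobolev_def)
  obtain F where [measurable]: "F \<in> borel_measurable borel" and F0: "\<And>x. x \<notin> \<Omega> \<Longrightarrow> F x = 0"
    and ae: "AE x in lborel. x \<in> \<Omega> \<longrightarrow> f x = F x"
    using Borel_representative[OF \<Omega> fm] by metis
  have finF: "?N F < top" "?S F < top"
    using f LN[OF ae, of p] LS[OF ae]
    by (auto simp: frac_sobolev_def Lp_norm_def gagliardo_seminorm_def epowr_less_top_iff)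
  have [measurable]: "?\<theta> n \<in> borel_measurable borel" for n
    by (intro borel_measurable_continuous_onI cutoff_continuous)
  have H: "(\<integral>\<^sup>+x. ennreal (\<bar>F x\<bar> powr p * ?D x powr (- (s * p))) \<partial>lborel) < top"
  proof -
    have "(\<integral>\<^sup>+x. ennreal (\<bar>F x\<bar> powr p * ?D x powr (- (s * p))) \<partial>lborel)
      \<le> (\<integral>\<^sup>+x. ennreal (\<bar>F x\<bar> powr p) * indicator \<Omega> x + ennreal (\<bar>F x\<bar> powr p * hardy_weight (s * p) \<Omega> x) * indicator \<Omega> x \<partial>lborel)"
    proof (intro nn_integral_mono)
      fix x
      show "ennreal (\<bar>F x\<bar> powr p * ?D x powr (- (s * p))) \<le> ennreal (\<bar>F x\<bar> powr p) * indicator \<Omega> x + ennreal (\<bar>F x\<bar> powr p * hardy_weight (s * p) \<Omega> x) * indicator \<Omega> x"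
      proof (cases "x \<in> \<Omega>")
        case True
        have "\<bar>F x\<bar> powr p * ?D x powr (- (s * p)) \<le> \<bar>F x\<bar> powr p * (1 + hardy_weight (s * p) \<Omega> x)"
          using complement_dist_powr_le[OF \<Omega> True, of "s * p"] s p by (intro mult_left_mono) auto
        also have "\<dots> = \<bar>F x\<bar> powr p + \<bar>F x\<bar> powr p * hardy_weight (s * p) \<Omega> x" by (simp add: algebra_simps)
        finally show ?thesis using True hardy_weight_nonneg[of "s * p" \<Omega> x]
          by (simp add: ennreal_leI flip: ennreal_plus)
      qed (use F0 p in simp)
    qed
    also have "\<dots> = ?N F + hardy_integral s p \<Omega> f"
      unfolding hardy_integral_eq[OF \<Omega> ae] Lp_mass_def by (rule nn_integral_add) auto
    also have "\<dots> < top" using finF hardy by simp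
    finally show ?thesis .
  qed
  have W: "(\<integral>\<^sup>+w. ennreal (product_majorant s p \<Omega> F w) \<partial>lborel) < top"
    by (rule product_majorant_integrable[OF s p \<Omega> _ F0 finF(2) H]) auto
  have limN: "(\<lambda>n. ?N (\<lambda>x. F x - ?\<theta> n x * F x)) \<longlonglongrightarrow> 0"
  proof (rule Lp_mass_tendsto_0[OF p0, where w="\<lambda>x. \<bar>F x\<bar> powr p"])
    show "\<bar>F x - ?\<theta> n x * F x\<bar> powr p \<le> \<bar>F x\<bar> powr p" for n x
    proof -
      have "F x - ?\<theta> n x * F x = (1 - ?\<theta> n x) * F x" by (simp add: algebra_simps)
      then have "\<bar>F x - ?\<theta> n x * F x\<bar> \<le> \<bar>F x\<bar>"
        using cutoff_range[of \<Omega> n x] by (simp add: abs_mult mult_left_le_one_le)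
      then show ?thesis using p by (intro powr_mono2) auto
    qed
    show "(\<lambda>n. F x - ?\<theta> n x * F x) \<longlonglongrightarrow> 0" if "x \<in> \<Omega>" for x
      using tendsto_diff[OF tendsto_const tendsto_mult[OF cutoff_tendsto[OF \<Omega> that] tendsto_const], of "F x" "F x"] by simp
  qed (use finF in \<open>auto simp: Lp_mass_def\<close>)
  have limS: "(\<lambda>n. ?S (\<lambda>x. F x - ?\<theta> n x * F x)) \<longlonglongrightarrow> 0"
  proof (rule Lp_mass_tendsto_0[OF p0, where w="product_majorant s p \<Omega> F"])
    fix n and w :: "'a \<times> 'a" assume w: "w \<in> \<Omega> \<times> \<Omega>"
    have eq: "(\<lambda>x. F x - ?\<theta> n x * F x) = (\<lambda>x. (1 - ?\<theta> n x) * F x)" by (simp add: algebra_simps)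
    have "\<bar>?Q (\<lambda>x. (1 - ?\<theta> n x) * F x) (fst w, snd w)\<bar> powr p \<le> product_majorant s p \<Omega> F (fst w, snd w)"
      by (rule product_majorant_bound[OF p F0])
         (use w cutoff_range[of \<Omega> n] cutoff_variation[OF \<Omega>, of _ n] in \<open>auto simp: abs_minus_commute\<close>)
    then show "\<bar>?Q (\<lambda>x. F x - ?\<theta> n x * F x) w\<bar> powr p \<le> product_majorant s p \<Omega> F w"
      unfolding eq by simp
  next
    fix w :: "'a \<times> 'a" assume w: "w \<in> \<Omega> \<times> \<Omega>"
    have lim: "(\<lambda>n. F x - ?\<theta> n x * F x) \<longlonglongrightarrow> 0" if "x \<in> \<Omega>" for x
      using tendsto_diff[OF tendsto_const tendsto_mult[OF cutoff_tendsto[OF \<Omega> that] tendsto_const], of "F x" "F x"] by simp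
    show "(\<lambda>n. ?Q (\<lambda>x. F x - ?\<theta> n x * F x) w) \<longlonglongrightarrow> 0"
      unfolding gagliardo_quotient_def divide_inverse
      using tendsto_mult[OF tendsto_diff[OF lim lim] tendsto_const] w by fastforce
  next
    have "(\<integral>\<^sup>+w. ennreal (product_majorant s p \<Omega> F w) * indicator (\<Omega> \<times> \<Omega>) w \<partial>lborel) \<le> (\<integral>\<^sup>+w. ennreal (product_majorant s p \<Omega> F w) \<partial>lborel)"
      by (intro nn_integral_mono) (auto simp: indicator_def)
    then show "(\<integral>\<^sup>+w. ennreal (product_majorant s p \<Omega> F w) * indicator (\<Omega> \<times> \<Omega>) w \<partial>lborel) < \<infinity>"
      using W by simp
  qed auto
  show ?thesis
    unfolding frac_sobolev_zero_def
  proof (intro CollectI conjI f allI impI)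
    fix e :: real assume e: "0 < e"
    define r where "r = (e / 2) powr p"
    \<comment> \<open>\<open>2 powr p * (\<eta> + \<eta>) = r / 2\<close>, and \<open>r\<close> is the bound that each half of the norm needs\<close>
    define \<eta> where "\<eta> = r / (4 * 2 powr p)"
    have r: "0 < r" using e by (simp add: r_def)
    have \<eta>: "0 < \<eta>" using r by (simp add: \<eta>_def)
    have "\<forall>\<^sub>F n in sequentially. ?N (\<lambda>x. F x - ?\<theta> n x * F x) < ennreal \<eta> \<and> ?S (\<lambda>x. F x - ?\<theta> n x * F x) < ennreal \<eta>"
      using limN limS \<eta> by (intro eventually_conj) (auto simp: order_tendsto_iff)
    then obtain n where n: "?N (\<lambda>x. F x - ?\<theta> n x * F x) < ennreal \<eta>" "?S (\<lambda>x. F x - ?\<theta> n x * F x) < ennreal \<eta>"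
      using eventually_happens by fastforce
    define G where "G x = ?\<theta> n x * F x" for x
    have [measurable]: "G \<in> borel_measurable borel" unfolding G_def by measurable
    obtain K where K: "compact K" "K \<subseteq> \<Omega>" "\<And>x. ?\<theta> n x \<noteq> 0 \<Longrightarrow> x \<in> K"
      using cutoff_support by metis
    have "Lp_mass p UNIV G \<le> ?N F"
      unfolding Lp_mass_def
    proof (intro nn_integral_mono)
      fix x
      have "\<bar>G x\<bar> \<le> \<bar>F x\<bar>"
        using cutoff_range[of \<Omega> n x] by (simp add: G_def abs_mult mult_left_le_one_le)
      then have "\<bar>G x\<bar> powr p \<le> \<bar>F x\<bar> powr p" using p by (intro powr_mono2) auto
      then show "ennreal (\<bar>G x\<bar> powr p) * indicator UNIV x \<le> ennreal (\<bar>F x\<bar> powr p) * indicator \<Omega> x"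
        using F0[of x] p by (cases "x \<in> \<Omega>") (auto simp: ennreal_leI G_def)
    qed
    then have GN: "Lp_mass p UNIV G < top" using finF by simp
    have "Lp_mass p UNIV (?Q G) \<le> (\<integral>\<^sup>+w. ennreal (product_majorant s p \<Omega> F w) \<partial>lborel)"
      unfolding Lp_mass_def
    proof (intro nn_integral_mono)
      fix w :: "'a \<times> 'a"
      have "\<forall>u. u \<notin> \<Omega> \<longrightarrow> ?\<theta> n u = 0" using K by blast
      then have "\<bar>?Q (\<lambda>x. ?\<theta> n x * F x) (fst w, snd w)\<bar> powr p \<le> product_majorant s p \<Omega> F (fst w, snd w)"
        by (intro product_majorant_bound[OF p F0] cutoff_range cutoff_variation[OF \<Omega>]) auto
      then show "ennreal (\<bar>?Q G w\<bar> powr p) * indicator UNIV w \<le> ennreal (product_majorant s p \<Omega> F w)"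
        by (simp add: G_def[abs_def] ennreal_leI)
    qed
    then have GS: "Lp_mass p UNIV (?Q G) < top" using W by simp
    have "x \<in> K" if "G x \<noteq> 0" for x using that K(3) by (auto simp: G_def)
    from mollification_approximates[OF p \<Omega> \<open>G \<in> borel_measurable borel\<close> K(1,2) this GN GS \<eta>]
    obtain g where g: "g \<in> test_functions \<Omega>" "Lp_mass p UNIV (\<lambda>x. G x - g x) \<le> ennreal \<eta>"
      "Lp_mass p UNIV (?Q (\<lambda>x. G x - g x)) \<le> ennreal \<eta>" by blast
    have [measurable]: "g \<in> borel_measurable borel"
      using g(1) smooth_borel_measurable[of g] by (simp add: test_functions_def)
    have small: "Lp_mass p A (\<lambda>x. u x + v x) < ennreal r"
      if [measurable]: "u \<in> borel_measurable borel" "v \<in> borel_measurable borel" "A \<in> sets borel"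
        and "Lp_mass p A u < ennreal \<eta>" "Lp_mass p UNIV v \<le> ennreal \<eta>"
      for u v and A :: "'b::euclidean_space set"
    proof -
      have "Lp_mass p A v \<le> ennreal \<eta>" using Lp_mass_mono_set[of A UNIV p v] that by auto
      have "Lp_mass p A (\<lambda>x. u x + v x) \<le> ?C * (Lp_mass p A u + Lp_mass p A v)"
        using p by (intro Lp_mass_add_le) auto
      also have "\<dots> \<le> ?C * (ennreal \<eta> + ennreal \<eta>)"
        using that \<open>Lp_mass p A v \<le> ennreal \<eta>\<close> by (intro mult_left_mono add_mono) auto
      also have "\<dots> = ennreal (r / 2)"
        using \<eta> by (simp add: \<eta>_def flip: ennreal_plus ennreal_mult)
      also have "\<dots> < ennreal r" using r by (intro ennreal_lessI) auto
      finally show ?thesis .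
    qed
    have aed: "AE x in lborel. x \<in> \<Omega> \<longrightarrow> f x - g x = F x - g x"
      using ae by eventually_elim auto
    have "?N (\<lambda>x. F x - g x) < ennreal r"
      using small[of "\<lambda>x. F x - G x" "\<lambda>x. G x - g x" \<Omega>] n g(2) by (simp add: G_def)
    moreover have "?S (\<lambda>x. F x - g x) < ennreal r"
    proof -
      have "?Q (\<lambda>x. F x - g x) = (\<lambda>w. ?Q (\<lambda>x. F x - G x) w + ?Q (\<lambda>x. G x - g x) w)"
        by (simp add: gagliardo_quotient_diff fun_eq_iff)
      then show ?thesis
        using small[of "?Q (\<lambda>x. F x - G x)" "?Q (\<lambda>x. G x - g x)" "\<Omega> \<times> \<Omega>"] n g(3) by (simp add: G_def[abs_def])
    qed
    ultimately have "frac_sobolev_norm s p \<Omega> (\<lambda>x. f x - g x) < ennreal e"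
      using LN[OF aed, of p] LS[OF aed] unfolding r_def
      by (intro frac_sobolev_norm_less[OF p e]) auto
    then show "\<exists>g\<in>test_functions \<Omega>. frac_sobolev_norm s p \<Omega> (\<lambda>x. f x - g x) < ennreal e"
      using g(1) by blast
  qed
qed

theorem theorem17:
  fixes s p :: real and \<Omega> :: "'a::euclidean_space set"
  assumes "0 < s" "s < 1" and "1 \<le> p"
    and "open \<Omega>"
    and "weak_frac_hardy s p \<Omega>"
  shows "frac_sobolev_zero s p \<Omega> = {f \<in> frac_sobolev s p \<Omega>. hardy_integral s p \<Omega> f < top}"
proof (intro equalityI subsetI)
  fix f assume f: "f \<in> frac_sobolev_zero s p \<Omega>"
  then have "f \<in> frac_sobolev s p \<Omega>" by (simp add: frac_sobolev_zero_def)
  then show "f \<in> {f \<in> frac_sobolev s p \<Omega>. hardy_integral s p \<Omega> f < top}"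
    using hardy_integral_finite_of_closure[OF assms(3-5) f] by simp
next
  fix f assume "f \<in> {f \<in> frac_sobolev s p \<Omega>. hardy_integral s p \<Omega> f < top}"
  then show "f \<in> frac_sobolev_zero s p \<Omega>"
    using test_functions_dense[OF assms(1-4)] by simp
qed

end
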